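(* Under the assumptions listed in the context, there exists a finite constant $K$, independent of $\lambda$, such that \[ d_{TV}(F_\lambda^\star, {\rm Po}(c/2))\leqslant |E[F^\star_\lambda] - c/2| + K\sqrt{\lambda\psi(\lambda)}. \]
   Context: Fix an integer $d\geq 1$ and set $W := [-\frac12,\frac12]^d$, $\hat W := [-1,1]^d$, $\check W := [-\frac14,\frac14]^d$. Let $\ell$ denote Lebesgue measure on $\mathbb{R}^d$. Given two mappings $\lambda\mapsto a(\lambda), b(\lambda)$, $\lambda>0$, write $a(\lambda)\asymp b(\lambda)$ if there exist constants $C,C'>0$ with $Cb(\lambda)\leqslant a(\lambda)\leqslant C'b(\lambda)$ for all sufficiently large $\lambda$. For every $\lambda>0$: $\eta_\lambda$ is a Poisson measure on $(\mathbb{R}^d,\mathscr{B}(\mathbb{R}^d))$ with control (intensity) measure $\lambda\ell$; $H_\lambda$ is a symmetric subset of $\mathbb{R}^d\times\mathbb{R}^d$ with $\ell^2(H_\lambda)<\infty$ such that there exists a measurable set $\mathbf{H}_\lambda\subset\mathbb{R}^d$ with $0\notin \mathbf{H}_\lambda$ and $H_\lambda=\{(x,y): x-y\in \mathbf{H}_\lambda\}$; $F_\lambda=\sum_{x,y\in\eta_\lambda\cap W}{\bf 1}_{H_\lambda}(x,y)$ and $F^\star_\lambda := \frac12 F_\lambda$ (the number of edges of the random geometric graph with vertices the points of $\eta_\lambda$ in $W$, two vertices $x,y$ being joined iff $(x,y)\in H_\lambda$). The occupation coefficients are $\psi(\lambda):=\ell(\mathbf{H}_\lambda\cap W)$, $\hat\psi(\lambda):=\ell(\mathbf{H}_\lambda\cap\hat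 W)$, $\check\psi(\lambda):=\ell(\mathbf{H}_\lambda\cap\check W)$. Assume that $\hat\psi(\lambda)\asymp\check\psi(\lambda)$, that $\lambda\psi(\lambda)\to 0$ as $\lambda\to\infty$, that the mapping $\lambda\mapsto\lambda^2\psi(\lambda)$ is bounded, and that there exists a finite constant $c>0$ such that ${\rm Var}(F_\lambda)\to 2c$ as $\lambda\to\infty$. ${\rm Po}(c/2)$ denotes a Poisson random variable with mean $c/2$, and $d_{TV}$ is the total variation distance between laws of $\mathbb{Z}_+$-valued random variables, $d_{TV}(X,Y)=\sup_{A\subset\mathbb{Z}_+}|P(X\in A)-P(Y\in A)|$.
   Formalization: The bound is proved for all sufficiently large λ (it can fail at a small λ, where ψ(λ) may vanish while F_λ does not), and the assumption ℓ²(H_λ)<∞ is dropped because, with H_λ translation invariant, it forces Var(F_λ)=0 and contradicts c>0. *)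

theory Defs
  imports "HOL-Probability.Probability"
begin

definition cubeW :: "'a::euclidean_space set" where
  "cubeW = cbox (-((1/2::real) *\<^sub>R One)) ((1/2::real) *\<^sub>R One)"

definition cubeW_hat :: "'a::euclidean_space set" where
  "cubeW_hat = cbox (- (One::'a)) One"

definition cubeW_check :: "'a::euclidean_space set" where
  "cubeW_check = cbox (-((1/4::real) *\<^sub>R One)) ((1/4::real) *\<^sub>R One)"

definition asymp_comparable :: "(real \<Rightarrow> real) \<Rightarrow> (real \<Rightarrow> real) \<Rightarrow> bool" where
  "asymp_comparable a b \<longleftrightarrow>
     (\<exists>C C'. C > 0 \<and> C' > 0 \<and> (\<forall>\<^sub>F l in at_top. C * b l \<le> a l \<and> a l \<le> C' * b l))"

text \<open>Poisson point process (Poisson measure) on the space 'a with control measure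
  lam * Lebesgue, realised on the probability space M.  Since the intensity is diffuse,
  the process is simple, so it is represented by its (locally finite) random support set
  eta omega.  The counts of bounded Borel sets are Poisson with mean lam * Lebesgue measure,
  and counts of disjoint bounded Borel sets are independent.\<close>
definition poisson_process :: "'b measure \<Rightarrow> real \<Rightarrow> ('b \<Rightarrow> 'a::euclidean_space set) \<Rightarrow> bool" where
  "poisson_process M lam eta \<longleftrightarrow>
     prob_space M \<and>
     (\<forall>\<omega>\<in>space M. \<forall>A. bounded A \<longrightarrow> finite (eta \<omega> \<inter> A)) \<and>
     (\<forall>A \<in> sets lborel. bounded A \<longrightarrow>
        (\<lambda>\<omega>. card (eta \<omega> \<inter> A)) \<in> measurable M (count_space UNIV) \<and>
        (\<forall>k::nat. measure M {\<omega> \<in> space M. card (eta \<omega> \<inter> A) = k}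
                 = (lam * measure lborel A) ^ k / fact k * exp (- (lam * measure lborel A)))) \<and>
     (\<forall>(As :: nat \<Rightarrow> 'a set) n.
        (\<forall>i<n. As i \<in> sets lborel \<and> bounded (As i)) \<and> disjoint_family_on As {..<n} \<longrightarrow>
        prob_space.indep_vars M (\<lambda>_. count_space UNIV) (\<lambda>i \<omega>. card (eta \<omega> \<inter> As i)) {..<n})"

text \<open>F = sum over x,y in eta \<inter> W of 1_H(x,y), with H = {(x,y). x - y \<in> Hb}.
  Diagonal terms vanish since 0 \<notin> Hb.\<close>
definition rgg_F :: "'a::euclidean_space set \<Rightarrow> 'a set \<Rightarrow> real" where
  "rgg_F Hb P = (\<Sum>x\<in>P \<inter> cubeW. \<Sum>y\<in>P \<inter> cubeW. if x - y \<in> Hb then 1 else 0)"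

definition dTV_poisson :: "'b measure \<Rightarrow> ('b \<Rightarrow> real) \<Rightarrow> real \<Rightarrow> real" where
  "dTV_poisson M X mu =
     (SUP A \<in> (UNIV :: nat set set).
        \<bar>measure M {\<omega> \<in> space M. X \<omega> \<in> real ` A} - measure_pmf.prob (poisson_pmf mu) A\<bar>)"

end

theory Submission
  imports Defs "HOL-Probability.Product_PMF"
begin

text \<open>
  The Chen--Stein method applied to a discretisation. Label the points of \<open>W\<close> by finitely many
  labels \<open>i\<close>, let \<open>Y\<^sub>i\<close> be the number of process points with label \<open>i\<close> (independent, Poisson with mean
  \<open>a\<^sub>i\<close>), and let \<open>E\<close> be a symmetric irreflexive relation on labels. The edge count
  \<open>N = 1/2 \<Sum>\<^sub>E Y\<^sub>i Y\<^sub>j\<close> satisfies \<open>N(Y + e\<^sub>i + e\<^sub>j) = N + 1 + D\<^sub>i + D\<^sub>j\<close> for \<open>(i, j) \<in> E\<close>, with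
  \<open>D\<^sub>i\<close> the degree, so the Mecke identity \<open>E[Y\<^sub>i g(Y)] = a\<^sub>i E[g(Y + e\<^sub>i)]\<close> bounds the Stein
  discrepancy of \<open>N\<close> by a constant times \<open>\<Sum>\<^sub>E a\<^sub>i a\<^sub>j E[D\<^sub>i]\<close>. The true edge set is approximated in
  measure by such label relations; the second factorial moment measure of the process is the
  product measure, so the edge counts then differ with small probability. In the limit the distance of the
  edge count to the Poisson law with the same mean is at most a constant times \<open>\<kappa> m\<close>, where \<open>m\<close> is
  the mean of \<open>F\<close> and \<open>\<kappa>\<close>, at most \<open>\<lambda>\<close> times the hat coefficient, bounds the expected degree;
  this is of order \<open>\<lambda>\<psi>(\<lambda>)\<close>.
\<close>

section \<open>Stein's equation for the Poisson law\<close>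

text \<open>The library's \<open>poisson_pmf\<close> is unspecified at rate \<open>0\<close>, which occurs here for null cells.\<close>

definition poisson0_pmf :: "real \<Rightarrow> nat pmf" where
  "poisson0_pmf a = (if a = 0 then return_pmf 0 else poisson_pmf a)"

lemma pmf_poisson0:
  assumes "a \<ge> 0"
  shows "pmf (poisson0_pmf a) k = a ^ k / fact k * exp (- a)"
  using assms by (auto simp: poisson0_pmf_def pmf_return power_0_left)

lemma nat_pmf_prob_sums:
  fixes p :: "nat pmf"
  shows "(\<lambda>k. indicator A k * pmf p k) sums measure_pmf.prob p A"
proof -
  have "(\<lambda>k. measure_pmf.prob p (if k \<in> A then {k} else {}))
          sums measure_pmf.prob p (\<Union>k. if k \<in> A then {k} else {})"
    by (rule measure_pmf.finite_measure_UNION) (auto simp: disjoint_family_on_def)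
  moreover have "(\<Union>k. if k \<in> A then {k} else {}) = A" by auto
  moreover have "measure_pmf.prob p (if k \<in> A then {k} else {}) = indicator A k * pmf p k" for k
    by (auto simp: measure_pmf_single)
  ultimately show ?thesis by simp
qed

text \<open>Multiplication by \<open>exp a\<close> leaves a power series whose coefficients do not
  involve \<open>a\<close>, so the probability can be differentiated termwise in the rate.\<close>

lemma poisson0_prob_sums:
  assumes "a \<ge> 0"
  shows "(\<lambda>k. indicator A k / fact k * a ^ k) sums (exp a * measure_pmf.prob (poisson0_pmf a) A)"
proof -
  have "(\<lambda>k. exp a * (indicator A k * (a ^ k / fact k * exp (- a))))
          sums (exp a * measure_pmf.prob (poisson0_pmf a) A)"
    using nat_pmf_prob_sums[of A "poisson0_pmf a"] assms
    by (intro sums_mult) (simp add: pmf_poisson0)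
  moreover have "exp a * (indicator A k * (a ^ k / fact k * exp (- a))) = indicator A k / fact k * a ^ k"
    for k by (simp add: exp_minus)
  ultimately show ?thesis by (simp only:)
qed

text \<open>The derivative in \<open>a\<close> of \<open>P(Po(a) \<in> A)\<close> is \<open>P(Po(a) + 1 \<in> A) - P(Po(a) \<in> A)\<close>.\<close>

lemma poisson0_prob_lipschitz:
  assumes "a \<ge> 0" "b \<ge> 0"
  shows "\<bar>measure_pmf.prob (poisson0_pmf a) A - measure_pmf.prob (poisson0_pmf b) A\<bar> \<le> \<bar>a - b\<bar>"
proof -
  define c :: "nat set \<Rightarrow> nat \<Rightarrow> real" where "c B k = indicator B k / fact k" for B k
  define g :: "real \<Rightarrow> real" where "g x = (\<Sum>k. c A k * x ^ k)" for x
  \<comment> \<open>Because \<open>Suc k / fact (Suc k) = 1 / fact k\<close>, formal differentiation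
    only shifts the set down by one.\<close>
  have diffs: "diffs (c A) = c {k. Suc k \<in> A}"
    by (auto simp: fun_eq_iff diffs_def c_def indicator_def)
  have summ: "summable (\<lambda>n. c B n * y ^ n)" for B and y :: real
  proof (rule summable_comparison_test')
    show "summable (\<lambda>n. norm (inverse (fact n) * y ^ n))"
      using summable_norm_exp[of y] by (simp add: field_simps)
    show "norm (c B n * y ^ n) \<le> norm (inverse (fact n) * y ^ n)" if "n \<ge> 0" for n
      by (auto simp: c_def indicator_def divide_simps)
  qed
  have deriv: "(g has_field_derivative (\<Sum>n. c {k. Suc k \<in> A} n * x ^ n)) (at x)" for x
    unfolding g_def using termdiffs_strong_converges_everywhere[of "c A" x] summ diffs by simp
  have val: "(\<Sum>n. c B n * x ^ n) = exp x * measure_pmf.prob (poisson0_pmf x) B" if "x \<ge> 0" for B x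
    using poisson0_prob_sums[OF that, of B] unfolding c_def by (simp add: sums_iff)
  \<comment> \<open>\<open>G\<close> is differentiable on the whole line but equals a Poisson
    probability only for nonnegative arguments; the mean value bound is therefore taken on
    \<open>{0..}\<close>.\<close>
  define G where "G x = exp (- x) * g x" for x
  have G: "G x = measure_pmf.prob (poisson0_pmf x) A" if "x \<ge> 0" for x
    using val[OF that, of A] by (simp add: G_def g_def exp_minus)
  have dG: "(G has_field_derivative (exp (- x) * (\<Sum>n. c {k. Suc k \<in> A} n * x ^ n) - exp (- x) * g x)) (at x)" for x
  proof -
    have "((\<lambda>x. exp (- x)) has_field_derivative - exp (- x)) (at x)"
      by (auto intro!: derivative_eq_intros)
    from DERIV_mult[OF this deriv[of x]] show ?thesis
      unfolding G_def by (simp add: algebra_simps)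
  qed
  \<comment> \<open>On the half-line the derivative is a difference of two probabilities, so its
    modulus is at most \<open>1\<close>.\<close>
  have bd: "norm (exp (- x) * (\<Sum>n. c {k. Suc k \<in> A} n * x ^ n) - exp (- x) * g x) \<le> 1" if "x \<ge> 0" for x
  proof -
    have "exp (- x) * (\<Sum>n. c {k. Suc k \<in> A} n * x ^ n) = measure_pmf.prob (poisson0_pmf x) {k. Suc k \<in> A}"
      using val[OF that] by (simp add: exp_minus)
    moreover have "exp (- x) * g x = measure_pmf.prob (poisson0_pmf x) A"
      using G[OF that] by (simp add: G_def)
    moreover have "\<bar>measure_pmf.prob p B - measure_pmf.prob p B'\<bar> \<le> 1" for p :: "nat pmf" and B B'
      using measure_pmf.prob_le_1[of p B] measure_pmf.prob_le_1[of p B']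
        measure_nonneg[of p B] measure_nonneg[of p B'] by linarith
    ultimately show ?thesis by simp
  qed
  have "norm (G a - G b) \<le> 1 * norm (a - b)"
    by (rule field_differentiable_bound[of "{0..}" G]) (use assms dG bd in \<open>auto intro: has_field_derivative_at_within\<close>)
  then show ?thesis using G assms by simp
qed

text \<open>Dominates the terms of the Stein solution by the exponential series, uniformly in
  \<open>k\<close>. A product of factorials divides the factorial of the sum; at
  \<open>k = 0\<close> the truncated \<open>k - 1\<close> is \<open>0\<close>.\<close>

lemma fact_pred_mult_le: "fact (k - 1) * fact i \<le> (fact (k + i) :: real)"
proof -
  have "fact (k - 1) * fact i \<le> (fact (k - 1 + i) :: nat)"
    by (intro dvd_imp_le fact_fact_dvd_fact) simp
  also have "\<dots> \<le> fact (k + i)" by (intro fact_mono) simp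
  finally have "real (fact (k - 1) * fact i) \<le> real (fact (k + i))" by (simp only: of_nat_le_iff)
  then show ?thesis by simp
qed

text \<open>The bound \<open>exp mu\<close> is far from the optimal Stein factor, but \<open>mu\<close> stays bounded in the
  application.\<close>

lemma poisson_stein_solution:
  assumes mu: "mu \<ge> 0"
  obtains f :: "nat \<Rightarrow> real" where
    "\<And>k. \<bar>f k\<bar> \<le> exp mu"
    "\<And>k. mu * f (Suc k) - real k * f k = indicator A k - measure_pmf.prob (poisson0_pmf mu) A"
proof -
  define q where "q = measure_pmf.prob (poisson0_pmf mu) A"
  define h :: "nat \<Rightarrow> real" where "h k = indicator A k - q" for k
  have q: "0 \<le> q" "q \<le> 1" by (auto simp: q_def)
  have h: "\<bar>h k\<bar> \<le> 1" for k using q by (auto simp: h_def indicator_def)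
  \<comment> \<open>Unrolling \<open>f k = (mu * f (Suc k) - h k) / k\<close> forward gives minus
    the sum of these terms. At \<open>k = 0\<close> truncated subtraction gives a finite value,
    which the equation multiplies by \<open>0\<close>.\<close>
  define t where "t k i = h (k + i) * mu ^ i * (fact (k - 1) / fact (k + i))" for k i
  define f where "f k = - (\<Sum>i. t k i)" for k
  have e: "(\<lambda>i. mu ^ i / fact i) sums exp mu"
    using exp_converges[of mu] by (simp add: field_simps)
  have tb: "norm (t k i) \<le> mu ^ i / fact i" for k i
  proof -
    have "fact (k - 1) / fact (k + i) \<le> (1 / fact i :: real)"
      using fact_pred_mult_le[of k i] by (simp add: divide_simps)
    then have "\<bar>h (k + i)\<bar> * mu ^ i * (fact (k - 1) / fact (k + i)) \<le> 1 * mu ^ i * (1 / fact i)"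
      using h mu by (intro mult_mono) auto
    then show ?thesis using mu by (simp add: t_def abs_mult)
  qed
  have ts: "summable (t k)" for k
    by (rule summable_comparison_test'[OF sums_summable[OF e]]) (use tb in auto)
  have "\<bar>f k\<bar> \<le> exp mu" for k
  proof -
    have "norm (\<Sum>i. t k i) \<le> (\<Sum>i. mu ^ i / fact i)"
      by (rule norm_suminf_le[OF tb sums_summable[OF e]])
    then show ?thesis using e by (simp add: f_def sums_iff)
  qed
  moreover have "mu * f (Suc k) - real k * f k = h k" for k
  proof (cases k)
    case 0
    \<comment> \<open>The equation at \<open>k = 0\<close> is the solvability condition:
      \<open>h\<close> has mean zero under the Poisson law, so its weighted series from index
      \<open>1\<close> on sums to \<open>- h 0\<close>.\<close>
    have "(\<lambda>i. indicator A i / fact i * mu ^ i - q * (mu ^ i / fact i)) sums (exp mu * q - q * exp mu)"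
      using poisson0_prob_sums[OF mu, of A] unfolding q_def[symmetric]
      by (intro sums_diff sums_mult e)
    then have *: "(\<lambda>i. h i * mu ^ i / fact i) sums 0"
      by (simp add: h_def algebra_simps diff_divide_distrib)
    then have "(\<lambda>i. h (Suc i) * mu ^ Suc i / fact (Suc i)) sums (0 - h 0)"
      by (subst sums_Suc_iff) simp
    moreover have "mu * t (Suc 0) i = h (Suc i) * mu ^ Suc i / fact (Suc i)" for i
      by (simp add: t_def)
    ultimately have "(\<lambda>i. mu * t (Suc 0) i) sums (- h 0)" by simp
    then have "mu * (\<Sum>i. t (Suc 0) i) = - h 0"
      using suminf_mult[OF ts, of mu "Suc 0"] by (simp add: sums_iff)
    then show ?thesis by (simp add: f_def 0)
  next
    case (Suc m)
    \<comment> \<open>For \<open>k > 0\<close> the head of the series contributes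
      \<open>h k / k\<close>, and the tail is the series at \<open>Suc k\<close> rescaled by
      \<open>mu / k\<close>.\<close>
    have "(\<Sum>i. t k i) = t k 0 + (\<Sum>i. t k (Suc i))"
      using suminf_split_head[OF ts, of k] by simp
    moreover have "real k * t k 0 = h k" using Suc by (simp add: t_def)
    moreover have "real k * t k (Suc i) = mu * t (Suc k) i" for i
      using Suc by (simp add: t_def)
    then have "real k * (\<Sum>i. t k (Suc i)) = mu * (\<Sum>i. t (Suc k) i)"
      using suminf_mult[OF ts, of mu "Suc k"]
        suminf_mult[of "\<lambda>i. t k (Suc i)" "real k"] ts[of k]
      by (simp add: summable_Suc_iff)
    ultimately show ?thesis by (simp add: f_def algebra_simps)
  qed
  ultimately show thesis using that[of f] unfolding h_def q_def by blast
qed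

section \<open>Quadratic forms in independent Poisson variables\<close>

text \<open>The Poisson weights satisfy \<open>(k + 1) * p (k + 1) = a * p k\<close>, so the
  identity is an index shift of the series, whose term at \<open>0\<close> vanishes.\<close>

lemma nn_integral_poisson0_mecke:
  assumes "a \<ge> 0"
  shows "(\<integral>\<^sup>+k. of_nat k * g k \<partial>poisson0_pmf a) = ennreal a * (\<integral>\<^sup>+k. g (Suc k) \<partial>poisson0_pmf a)"
proof -
  let ?p = "\<lambda>k. ennreal (pmf (poisson0_pmf a) k)"
  have p: "?p (Suc k) * of_nat (Suc k) = ennreal a * ?p k" for k
    using assms
    by (simp add: pmf_poisson0 ennreal_of_nat_eq_real_of_nat ennreal_mult[symmetric] del: of_nat_Suc)
  have "(\<integral>\<^sup>+k. of_nat k * g k \<partial>poisson0_pmf a) = (\<Sum>k. ?p k * (of_nat k * g k))"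
    by (simp add: nn_integral_measure_pmf nn_integral_count_space_nat)
  also have "\<dots> = (\<Sum>k. ?p (k + 1) * (of_nat (k + 1) * g (k + 1))) + (\<Sum>k<1. ?p k * (of_nat k * g k))"
    by (rule suminf_offset) auto
  also have "\<dots> = (\<Sum>k. ennreal a * (?p k * g (Suc k)))"
    using p by (simp add: mult.assoc[symmetric] del: of_nat_Suc)
  also have "\<dots> = ennreal a * (\<integral>\<^sup>+k. g (Suc k) \<partial>poisson0_pmf a)"
    by (simp add: nn_integral_measure_pmf nn_integral_count_space_nat)
  finally show ?thesis .
qed

definition incr :: "nat \<Rightarrow> (nat \<Rightarrow> nat) \<Rightarrow> nat \<Rightarrow> nat" where
  "incr i y = y(i := Suc (y i))"

context
  fixes I :: "nat set" and a :: "nat \<Rightarrow> real" and Q :: "(nat \<Rightarrow> nat) pmf"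
  assumes fin: "finite I" and a: "\<And>i. i \<in> I \<Longrightarrow> a i \<ge> 0"
    and Q: "Q = Pi_pmf I 0 (\<lambda>i. poisson0_pmf (a i))"
begin

text \<open>By independence coordinate \<open>i\<close> splits off from the others, and the
  one-dimensional identity applies to the inner integral.\<close>

lemma nn_integral_Pi_poisson0_mecke:
  assumes i: "i \<in> I"
  shows "(\<integral>\<^sup>+y. of_nat (y i) * g y \<partial>Q) = ennreal (a i) * (\<integral>\<^sup>+y. g (incr i y) \<partial>Q)"
proof -
  let ?R = "Pi_pmf (I - {i}) 0 (\<lambda>i. poisson0_pmf (a i))"
  have "Pi_pmf (insert i (I - {i})) 0 (\<lambda>i. poisson0_pmf (a i)) =
      map_pmf (\<lambda>(y, f). f(i := y)) (pair_pmf (poisson0_pmf (a i)) ?R)"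
    using fin by (intro Pi_pmf_insert) auto
  then have Q': "Q = map_pmf (\<lambda>(y, f). f(i := y)) (pair_pmf (poisson0_pmf (a i)) ?R)"
    using i by (simp add: Q insert_absorb)
  have swap: "(\<integral>\<^sup>+y. g y \<partial>Q) = (\<integral>\<^sup>+f. \<integral>\<^sup>+k. g (f(i := k)) \<partial>poisson0_pmf (a i) \<partial>?R)" for g
  proof -
    have "(\<integral>\<^sup>+y. g y \<partial>Q) = (\<integral>\<^sup>+x. g (case x of (y, f) \<Rightarrow> f(i := y)) \<partial>pair_pmf (poisson0_pmf (a i)) ?R)"
      by (simp add: Q')
    also have "\<dots> = (\<integral>\<^sup>+x. g (case x of (f, y) \<Rightarrow> f(i := y)) \<partial>pair_pmf ?R (poisson0_pmf (a i)))"
      by (subst pair_commute_pmf) (simp add: case_prod_unfold)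
    also have "\<dots> = (\<integral>\<^sup>+f. \<integral>\<^sup>+k. g (f(i := k)) \<partial>poisson0_pmf (a i) \<partial>?R)"
      by (simp add: nn_integral_pair_pmf')
    finally show ?thesis .
  qed
  show ?thesis
    using nn_integral_poisson0_mecke[OF a[OF i]]
    by (simp add: swap incr_def nn_integral_cmult)
qed

lemma Pi_poisson0_mecke:
  fixes g :: "(nat \<Rightarrow> nat) \<Rightarrow> real"
  assumes i: "i \<in> I"
  shows "integrable Q (\<lambda>y. g (incr i y)) \<Longrightarrow> integrable Q (\<lambda>y. real (y i) * g y)"
    and "(\<integral>y. real (y i) * g y \<partial>Q) = a i * (\<integral>y. g (incr i y) \<partial>Q)"
proof -
  let ?D = "density (distr Q (count_space UNIV) (incr i)) (\<lambda>_. ennreal (a i))"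
  \<comment> \<open>On indicators the nonnegative identity says that two measures coincide:
    \<open>Q\<close> weighted by \<open>y i\<close>, and \<open>a i\<close> times the image of
    \<open>Q\<close> under \<open>incr i\<close>. Integrability and integrals of signed
    \<open>g\<close> then transfer together.\<close>
  have D: "density Q (\<lambda>y. ennreal (real (y i))) = ?D"
  proof (rule measure_eqI)
    fix A assume "A \<in> sets (density Q (\<lambda>y. ennreal (real (y i))))"
    have "emeasure (distr Q (count_space UNIV) (incr i)) A = (\<integral>\<^sup>+y. indicator A (incr i y) \<partial>Q)"
      by (subst nn_integral_indicator[symmetric]) (simp_all add: nn_integral_distr del: nn_integral_indicator)
    then show "emeasure (density Q (\<lambda>y. ennreal (real (y i)))) A = emeasure ?D A"
      using nn_integral_Pi_poisson0_mecke[OF i, of "indicator A"]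
      by (simp add: emeasure_density nn_integral_distr nn_integral_cmult ennreal_of_nat_eq_real_of_nat)
  qed simp
  show "integrable Q (\<lambda>y. g (incr i y)) \<Longrightarrow> integrable Q (\<lambda>y. real (y i) * g y)"
    using integrable_density[of g Q "\<lambda>y. real (y i)"]
      integrable_density[of g "distr Q (count_space UNIV) (incr i)" "\<lambda>_. a i"] a[OF i]
    by (simp add: D integrable_distr_eq)
  show "(\<integral>y. real (y i) * g y \<partial>Q) = a i * (\<integral>y. g (incr i y) \<partial>Q)"
    using integral_density[of g Q "\<lambda>y. real (y i)"]
      integral_density[of g "distr Q (count_space UNIV) (incr i)" "\<lambda>_. a i"] a[OF i]
    by (simp add: D integral_distr)
qed

lemma Pi_poisson0_mean:
  assumes "i \<in> I"
  shows "integrable Q (\<lambda>y. real (y i))" "(\<integral>y. real (y i) \<partial>Q) = a i"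
  using Pi_poisson0_mecke[OF assms, of "\<lambda>_. 1"] by simp_all

text \<open>The identity is applied at \<open>i\<close> and then at \<open>j\<close>; as
  \<open>i \<noteq> j\<close>, the increment at \<open>i\<close> leaves the factor
  \<open>y j\<close> untouched.\<close>

lemma Pi_poisson0_mecke2:
  fixes g :: "(nat \<Rightarrow> nat) \<Rightarrow> real"
  assumes ij: "i \<in> I" "j \<in> I" "i \<noteq> j" and g: "integrable Q (\<lambda>y. g (incr i (incr j y)))"
  shows "integrable Q (\<lambda>y. real (y i) * real (y j) * g y)"
    and "(\<integral>y. real (y i) * real (y j) * g y \<partial>Q) = a i * a j * (\<integral>y. g (incr i (incr j y)) \<partial>Q)"
  using Pi_poisson0_mecke[OF ij(1), of "\<lambda>y. real (y j) * g y"]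
    Pi_poisson0_mecke[OF ij(2), of "\<lambda>y. g (incr i y)"] ij(3) g
  by (simp_all add: incr_def mult.assoc)

end

section \<open>Edge counts of a relation on labels and their Stein bound\<close>

definition edges :: "(nat \<times> nat) set \<Rightarrow> (nat \<Rightarrow> nat) \<Rightarrow> nat" where
  "edges E y = (\<Sum>(i, j)\<in>E. y i * y j)"

text \<open>The degree of label \<open>i\<close>. The value type is general because the same sum is
  taken over random counts, in \<open>nat\<close>, and over their means, in
  \<open>real\<close>.\<close>

definition nbs :: "(nat \<times> nat) set \<Rightarrow> nat \<Rightarrow> (nat \<Rightarrow> 'a) \<Rightarrow> 'a :: comm_monoid_add" where
  "nbs E i y = (\<Sum>j\<in>E `` {i}. y j)"

text \<open>Transposition matches the part of \<open>E\<close> above the diagonal with the part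
  below it, with equal contributions. Halving \<open>edges E y\<close> with \<open>div\<close> is
  therefore exact.\<close>

lemma even_edges:
  assumes "finite E" "sym E" "irrefl E"
  shows "even (edges E y)"
proof -
  let ?L = "{(i, j). (i, j) \<in> E \<and> i < j}" and ?G = "{(i, j). (i, j) \<in> E \<and> j < i}"
  have E: "E = ?L \<union> ?G"
    using assms(3) by (auto simp: irrefl_def) (metis linorder_neqE_nat)
  have fin: "finite ?L" "finite ?G" by (rule finite_subset[OF _ assms(1)]; auto)+
  have "edges E y = (\<Sum>(i, j)\<in>?L. y i * y j) + (\<Sum>(i, j)\<in>?G. y i * y j)"
    unfolding edges_def using fin by (subst E, subst sum.union_disjoint) auto
  also have "(\<Sum>(i, j)\<in>?G. y i * y j) = (\<Sum>(i, j)\<in>?L. y i * y j)"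
    by (rule sum.reindex_bij_witness[of _ "\<lambda>(i, j). (j, i)" "\<lambda>(i, j). (j, i)"])
      (use assms(2) in \<open>auto dest: symD\<close>)
  finally show ?thesis by simp
qed

text \<open>A new point at \<open>i\<close> is joined to every point with a neighbouring label, once
  in each order; irreflexivity rules out a term with both entries equal to \<open>i\<close>.\<close>

lemma edges_incr:
  assumes "finite E" "sym E" "irrefl E"
  shows "edges E (incr i y) = edges E y + 2 * nbs E i y"
proof -
  have "edges E (incr i y) =
      (\<Sum>(p, q)\<in>E. y p * y q + (if p = i then y q else 0) + (if q = i then y p else 0))"
    unfolding edges_def by (rule sum.cong) (use assms(3) in \<open>auto simp: incr_def irrefl_def\<close>)
  also have "\<dots> = edges E y + (\<Sum>(p, q)\<in>E. if p = i then y q else 0) + (\<Sum>(p, q)\<in>E. if q = i then y p else 0)"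
    by (simp add: edges_def case_prod_unfold sum.distrib)
  also have "(\<Sum>(p, q)\<in>E. if p = i then y q else 0) = nbs E i y"
  proof -
    have "(\<Sum>(p, q)\<in>E. if p = i then y q else 0) = (\<Sum>(p, q)\<in>{e \<in> E. fst e = i}. y q)"
      using assms(1) by (simp add: sum.inter_filter case_prod_unfold)
    also have "\<dots> = nbs E i y" unfolding nbs_def
      by (rule sum.reindex_bij_witness[of _ "\<lambda>q. (i, q)" snd]) auto
    finally show ?thesis .
  qed
  also have "(\<Sum>(p, q)\<in>E. if q = i then y p else 0) = nbs E i y"
  proof -
    have "(\<Sum>(p, q)\<in>E. if q = i then y p else 0) = (\<Sum>(p, q)\<in>{e \<in> E. snd e = i}. y p)"
      using assms(1) by (simp add: sum.inter_filter case_prod_unfold)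
    also have "\<dots> = nbs E i y" unfolding nbs_def
      by (rule sum.reindex_bij_witness[of _ "\<lambda>p. (p, i)" fst]) (use assms(2) in \<open>auto dest: symD\<close>)
    finally show ?thesis .
  qed
  finally show ?thesis by simp
qed

text \<open>The \<open>Suc\<close> here becomes the edge between the two added points when both
  endpoints of an edge are incremented.\<close>

lemma nbs_incr:
  assumes "finite E" "(j, i) \<in> E"
  shows "nbs E j (incr i y) = Suc (nbs E j y)"
proof -
  have f: "finite (E `` {j})" using assms(1) by (rule finite_Image)
  have "nbs E j (incr i y) = (\<Sum>k\<in>E `` {j}. y k + (if k = i then 1 else 0))"
    unfolding nbs_def by (rule sum.cong) (auto simp: incr_def)
  also have "\<dots> = Suc (nbs E j y)"
    using f assms(2) by (simp add: sum.distrib nbs_def)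
  finally show ?thesis .
qed

text \<open>The Mecke identity turns the mean of \<open>N * f N\<close> into means of shifted values
  of \<open>f\<close>, one for each edge. The shifted argument differs from \<open>Suc N\<close>
  only when an endpoint already has neighbours, so the error weighs each edge by expected
  degrees.\<close>

lemma edges_poisson_stein:
  fixes E :: "(nat \<times> nat) set" and a :: "nat \<Rightarrow> real"
  assumes I: "finite I" "E \<subseteq> I \<times> I" and E: "sym E" "irrefl E"
    and a: "\<And>i. i \<in> I \<Longrightarrow> a i \<ge> 0"
    and mu: "mu = (\<Sum>(i, j)\<in>E. a i * a j) / 2"
  shows "\<bar>measure_pmf.prob (Pi_pmf I 0 (\<lambda>i. poisson0_pmf (a i))) {y. edges E y div 2 \<in> A}
            - measure_pmf.prob (poisson0_pmf mu) A\<bar>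
         \<le> 2 * exp mu * (\<Sum>(i, j)\<in>E. a i * a j * nbs E i a)"
proof -
  define Q where "Q = Pi_pmf I 0 (\<lambda>i. poisson0_pmf (a i))"
  have fE: "finite E" using I by (meson finite_SigmaI finite_subset)
  have aE: "a i \<ge> 0" "a j \<ge> 0" "i \<in> I" "j \<in> I" "i \<noteq> j" "(j, i) \<in> E" if "(i, j) \<in> E" for i j
    using that I a E by (auto simp: irrefl_def dest: symD)
  have mu0: "mu \<ge> 0" unfolding mu
    by (intro divide_nonneg_nonneg sum_nonneg) (auto intro!: mult_nonneg_nonneg dest: aE(1,2))
  define N where "N y = edges E y div 2" for y
  have N2: "real (edges E y) = 2 * real (N y)" for y
    using even_edges[OF fE E, of y] by (auto simp: N_def elim!: evenE)
  obtain f where f: "\<And>k. \<bar>f k\<bar> \<le> exp mu"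
    and stein: "\<And>k. mu * f (Suc k) - real k * f k = indicator A k - measure_pmf.prob (poisson0_pmf mu) A"
    using poisson_stein_solution[OF mu0, of A] by blast
  have int_f: "integrable Q (\<lambda>y. f (u y))" for u
    by (rule measure_pmf.integrable_const_bound[of _ "exp mu"]) (use f in auto)
  define D where "D i y = nbs E i y" for i and y :: "nat \<Rightarrow> nat"
  \<comment> \<open>Adding a point at \<open>j\<close> raises \<open>N\<close> by
    \<open>D j y\<close>; adding one at \<open>i\<close> afterwards raises it by the updated degree
    \<open>Suc (D i y)\<close>.\<close>
  have incr2: "N (incr i (incr j y)) = Suc (N y) + (D i y + D j y)" if "(i, j) \<in> E" for i j y
    using edges_incr[OF fE E, of i "incr j y"] edges_incr[OF fE E, of j y] nbs_incr[OF fE that, of y]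
    by (simp add: N_def D_def)
  have D_int: "integrable Q (\<lambda>y. real (D i y))" and D_mean: "(\<integral>y. real (D i y) \<partial>Q) = nbs E i a" for i
  proof -
    have *: "integrable Q (\<lambda>y. real (y j)) \<and> (\<integral>y. real (y j) \<partial>Q) = a j" if "j \<in> E `` {i}" for j
    proof -
      have "j \<in> I" using that I(2) by auto
      then show ?thesis using Pi_poisson0_mean[OF I(1) a Q_def] by blast
    qed
    show "integrable Q (\<lambda>y. real (D i y))"
      unfolding D_def nbs_def of_nat_sum by (rule Bochner_Integration.integrable_sum) (use * in auto)
    show "(\<integral>y. real (D i y) \<partial>Q) = nbs E i a"
      unfolding D_def nbs_def of_nat_sum
      by (subst Bochner_Integration.integral_sum) (use * in auto)
  qed
  have mecke: "integrable Q (\<lambda>y. real (y i) * real (y j) * f (N y))"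
    "(\<integral>y. real (y i) * real (y j) * f (N y) \<partial>Q) = a i * a j * (\<integral>y. f (Suc (N y) + (D i y + D j y)) \<partial>Q)"
    if "(i, j) \<in> E" for i j
  proof -
    have *: "integrable Q (\<lambda>y. f (N (incr i (incr j y))))" by (rule int_f)
    show "integrable Q (\<lambda>y. real (y i) * real (y j) * f (N y))"
      "(\<integral>y. real (y i) * real (y j) * f (N y) \<partial>Q) = a i * a j * (\<integral>y. f (Suc (N y) + (D i y + D j y)) \<partial>Q)"
      using Pi_poisson0_mecke2[OF I(1) a Q_def aE(3-5)[OF that] *] incr2[OF that] by simp_all
  qed
  have Nf: "real (N y) * f (N y) = (\<Sum>(i, j)\<in>E. real (y i) * real (y j) * f (N y)) / 2" for y
  proof -
    have "real (N y) * f (N y) = real (edges E y) * f (N y) / 2" using N2 by simp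
    then show ?thesis by (simp add: edges_def sum_distrib_right case_prod_unfold)
  qed
  have Nf_int: "integrable Q (\<lambda>y. real (N y) * f (N y))"
    unfolding Nf by (intro integrable_divide Bochner_Integration.integrable_sum) (auto intro: mecke)
  have Nf_mean: "(\<integral>y. real (N y) * f (N y) \<partial>Q)
      = (\<Sum>(i, j)\<in>E. a i * a j * (\<integral>y. f (Suc (N y) + (D i y + D j y)) \<partial>Q)) / 2"
  proof -
    have "(\<integral>y. real (N y) * f (N y) \<partial>Q)
        = (\<Sum>e\<in>E. \<integral>y. (case e of (i, j) \<Rightarrow> real (y i) * real (y j) * f (N y)) \<partial>Q) / 2"
      unfolding Nf by (subst integral_divide_zero, subst Bochner_Integration.integral_sum)
        (auto intro: mecke)
    also have "(\<Sum>e\<in>E. \<integral>y. (case e of (i, j) \<Rightarrow> real (y i) * real (y j) * f (N y)) \<partial>Q)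
      = (\<Sum>(i, j)\<in>E. a i * a j * (\<integral>y. f (Suc (N y) + (D i y + D j y)) \<partial>Q))"
      by (rule sum.cong) (auto simp: mecke)
    finally show ?thesis .
  qed
  have step: "\<bar>(\<integral>y. f (Suc (N y)) \<partial>Q) - (\<integral>y. f (Suc (N y) + (D i y + D j y)) \<partial>Q)\<bar>
      \<le> 2 * exp mu * (nbs E i a + nbs E j a)" for i j
  proof -
    \<comment> \<open>The difference is zero when both degrees vanish and at most
      \<open>2 * exp mu\<close> otherwise; degrees are integers, so their sum is then at least
      \<open>1\<close>.\<close>
    have pt: "\<bar>f (Suc (N y)) - f (Suc (N y) + (D i y + D j y))\<bar> \<le> 2 * exp mu * (real (D i y) + real (D j y))" for y
    proof (cases "D i y + D j y = 0")
      case False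
      then have "1 \<le> real (D i y) + real (D j y)" by linarith
      then have "2 * exp mu * 1 \<le> 2 * exp mu * (real (D i y) + real (D j y))"
        by (intro mult_left_mono) auto
      then show ?thesis using f[of "Suc (N y)"] f[of "Suc (N y) + (D i y + D j y)"] by linarith
    qed simp
    have "\<bar>(\<integral>y. f (Suc (N y)) \<partial>Q) - (\<integral>y. f (Suc (N y) + (D i y + D j y)) \<partial>Q)\<bar>
        = norm (\<integral>y. f (Suc (N y)) - f (Suc (N y) + (D i y + D j y)) \<partial>Q)"
      by (simp add: int_f del: add_Suc)
    also have "\<dots> \<le> (\<integral>y. norm (f (Suc (N y)) - f (Suc (N y) + (D i y + D j y))) \<partial>Q)"
      by (rule integral_norm_bound)
    also have "\<dots> \<le> (\<integral>y. 2 * exp mu * (real (D i y) + real (D j y)) \<partial>Q)"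
      by (rule integral_mono)
        (auto intro!: D_int int_f integrable_abs Bochner_Integration.integrable_diff pt simp del: add_Suc)
    also have "\<dots> = 2 * exp mu * (nbs E i a + nbs E j a)"
      using D_int D_mean by simp
    finally show ?thesis .
  qed
  have symsum: "(\<Sum>(i, j)\<in>E. a i * a j * nbs E j a) = (\<Sum>(i, j)\<in>E. a i * a j * nbs E i a)"
    by (rule sum.reindex_bij_witness[of _ "\<lambda>(i, j). (j, i)" "\<lambda>(i, j). (j, i)"])
      (use E(1) in \<open>auto dest: symD\<close>)
  have "measure_pmf.prob Q {y. N y \<in> A} - measure_pmf.prob (poisson0_pmf mu) A
      = (\<integral>y. indicator A (N y) - measure_pmf.prob (poisson0_pmf mu) A \<partial>Q)"
  proof -
    have "(\<integral>y. indicator A (N y) \<partial>Q) = measure_pmf.prob Q {y. N y \<in> A}"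
    proof -
      have "(\<integral>y. indicator A (N y) \<partial>Q) = (\<integral>y. indicat_real {y. N y \<in> A} y \<partial>Q)"
        by (simp add: indicator_def)
      then show ?thesis by simp
    qed
    moreover have "integrable Q (\<lambda>y. indicat_real A (N y))"
      by (rule measure_pmf.integrable_const_bound[of _ 1]) auto
    ultimately show ?thesis by simp
  qed
  also have "\<dots> = (\<integral>y. mu * f (Suc (N y)) - real (N y) * f (N y) \<partial>Q)"
    by (simp add: stein)
  also have "\<dots> = mu * (\<integral>y. f (Suc (N y)) \<partial>Q) - (\<integral>y. real (N y) * f (N y) \<partial>Q)"
    by (simp add: int_f Nf_int)
  \<comment> \<open>Since \<open>mu\<close> is half the sum of \<open>a i * a j\<close>, the two
    terms combine edge by edge.\<close>
  also have "\<dots> = (\<Sum>(i, j)\<in>E. a i * a j *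
      ((\<integral>y. f (Suc (N y)) \<partial>Q) - (\<integral>y. f (Suc (N y) + (D i y + D j y)) \<partial>Q))) / 2"
    unfolding Nf_mean mu
    by (simp add: case_prod_unfold sum_distrib_right sum_subtractf right_diff_distrib diff_divide_distrib sum_divide_distrib)
  finally have "\<bar>measure_pmf.prob Q {y. N y \<in> A} - measure_pmf.prob (poisson0_pmf mu) A\<bar>
    = \<bar>\<Sum>(i, j)\<in>E. a i * a j *
      ((\<integral>y. f (Suc (N y)) \<partial>Q) - (\<integral>y. f (Suc (N y) + (D i y + D j y)) \<partial>Q))\<bar> / 2"
    by (simp only: abs_divide abs_numeral)
  also have "\<dots> \<le> (\<Sum>(i, j)\<in>E. a i * a j * (2 * exp mu * (nbs E i a + nbs E j a))) / 2"
  proof (intro divide_right_mono order.trans[OF sum_abs] sum_mono)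
    fix e assume e: "e \<in> E"
    obtain i j where ij: "e = (i, j)" by force
    show "\<bar>case e of (i, j) \<Rightarrow> a i * a j *
      ((\<integral>y. f (Suc (N y)) \<partial>Q) - (\<integral>y. f (Suc (N y) + (D i y + D j y)) \<partial>Q))\<bar>
      \<le> (case e of (i, j) \<Rightarrow> a i * a j * (2 * exp mu * (nbs E i a + nbs E j a)))"
      using aE[of i j] e ij step[of i j] by (auto simp: abs_mult intro!: mult_left_mono simp del: add_Suc)
  qed simp
  also have "\<dots> = exp mu * ((\<Sum>(i, j)\<in>E. a i * a j * nbs E i a) + (\<Sum>(i, j)\<in>E. a i * a j * nbs E j a))"
    unfolding sum.distrib[symmetric] sum_distrib_left sum_divide_distrib
    by (rule sum.cong) (auto simp: algebra_simps)
  also have "\<dots> = 2 * exp mu * (\<Sum>(i, j)\<in>E. a i * a j * nbs E i a)" by (simp add: symsum)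
  finally show ?thesis unfolding Q_def N_def .
qed

section \<open>Approximation of relations by finite labellings\<close>

definition labset :: "'a measure \<Rightarrow> ('a \<Rightarrow> nat) \<Rightarrow> (nat \<times> nat) set \<Rightarrow> ('a \<times> 'a) set" where
  "labset U lb E = {p \<in> space (U \<Otimes>\<^sub>M U). (lb (fst p), lb (snd p)) \<in> E}"

definition labelling :: "'a measure \<Rightarrow> ('a \<Rightarrow> nat) \<Rightarrow> bool" where
  "labelling U lb \<longleftrightarrow> lb \<in> measurable U (count_space UNIV) \<and> finite (lb ` space U)"

definition approximable :: "'a measure \<Rightarrow> ('a \<times> 'a) set \<Rightarrow> bool" where
  "approximable U C \<longleftrightarrow> (\<forall>e>0. \<exists>lb E. labelling U lb \<and>
     measure (U \<Otimes>\<^sub>M U) (sym_diff C (labset U lb E)) < e)"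

text \<open>\<open>labset U lb Id\<close> is the union of the squares of the cells and contains the
  diagonal. Making its measure arbitrarily small excludes atoms, in the form in which labellings use
  this.\<close>

definition diffuse :: "'a measure \<Rightarrow> bool" where
  "diffuse U \<longleftrightarrow> (\<forall>e>0. \<exists>lb. labelling U lb \<and> measure (U \<Otimes>\<^sub>M U) (labset U lb Id) < e)"

lemma sets_labset:
  assumes "labelling U lb"
  shows "labset U lb E \<in> sets (U \<Otimes>\<^sub>M U)"
proof -
  have [measurable]: "lb \<in> measurable U (count_space UNIV)" using assms by (simp add: labelling_def)
  show ?thesis unfolding labset_def by measurable
qed

text \<open>The common refinement of two labellings, coded back into a single natural
  number.\<close>

lemma labelling_prod_encode:
  assumes "labelling U f" "labelling U g"
  shows "labelling U (\<lambda>x. prod_encode (f x, g x))"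
proof -
  have [measurable]: "f \<in> measurable U (count_space UNIV)" "g \<in> measurable U (count_space UNIV)"
    using assms by (simp_all add: labelling_def)
  have "finite (prod_encode ` (f ` space U \<times> g ` space U))"
    using assms by (auto simp: labelling_def)
  then have "finite ((\<lambda>x. prod_encode (f x, g x)) ` space U)"
    by (rule rev_finite_subset) auto
  moreover have "(\<lambda>x. prod_encode (f x, g x)) \<in> measurable U (count_space UNIV)" by measurable
  ultimately show ?thesis by (simp add: labelling_def)
qed

lemma finite_measure_pair:
  assumes "finite_measure U"
  shows "finite_measure (U \<Otimes>\<^sub>M U)"
  using assms by (simp add: finite_measure_pair_measure)

lemma approximable_compl:
  assumes "C \<subseteq> space (U \<Otimes>\<^sub>M U)" "approximable U C"
  shows "approximable U (space (U \<Otimes>\<^sub>M U) - C)"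
  unfolding approximable_def
proof (intro allI impI)
  fix e :: real assume "e > 0"
  then obtain lb E where *: "labelling U lb" "measure (U \<Otimes>\<^sub>M U) (sym_diff C (labset U lb E)) < e"
    using assms(2) unfolding approximable_def by blast
  have "sym_diff (space (U \<Otimes>\<^sub>M U) - C) (labset U lb (- E)) = sym_diff C (labset U lb E)"
    using assms(1) by (auto simp: labset_def)
  then show "\<exists>lb E. labelling U lb \<and>
     measure (U \<Otimes>\<^sub>M U) (sym_diff (space (U \<Otimes>\<^sub>M U) - C) (labset U lb E)) < e"
    using * by metis
qed

lemma approximable_Un:
  assumes U: "finite_measure U" and C: "C \<in> sets (U \<Otimes>\<^sub>M U)" "D \<in> sets (U \<Otimes>\<^sub>M U)"
    and ap: "approximable U C" "approximable U D"
  shows "approximable U (C \<union> D)"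
  unfolding approximable_def
proof (intro allI impI)
  interpret UU: finite_measure "U \<Otimes>\<^sub>M U" using U by (rule finite_measure_pair)
  fix e :: real assume "e > 0"
  then have "e / 2 > 0" by simp
  then obtain f E g F where f: "labelling U f" "measure (U \<Otimes>\<^sub>M U) (sym_diff C (labset U f E)) < e / 2"
    and g: "labelling U g" "measure (U \<Otimes>\<^sub>M U) (sym_diff D (labset U g F)) < e / 2"
    using ap unfolding approximable_def by blast
  define lb where "lb x = prod_encode (f x, g x)" for x
  define G where "G = {(i, j). (fst (prod_decode i), fst (prod_decode j)) \<in> E
      \<or> (snd (prod_decode i), snd (prod_decode j)) \<in> F}"
  have lb: "labelling U lb" unfolding lb_def by (rule labelling_prod_encode) fact+
  have [measurable]: "labset U f E \<in> sets (U \<Otimes>\<^sub>M U)" "labset U g F \<in> sets (U \<Otimes>\<^sub>M U)"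
    using f g by (auto intro: sets_labset)
  note C[measurable]
  have "labset U lb G = labset U f E \<union> labset U g F"
    by (auto simp: labset_def lb_def G_def)
  then have "measure (U \<Otimes>\<^sub>M U) (sym_diff (C \<union> D) (labset U lb G))
      \<le> measure (U \<Otimes>\<^sub>M U) (sym_diff C (labset U f E) \<union> sym_diff D (labset U g F))"
    by (intro UU.finite_measure_mono) auto
  also have "\<dots> \<le> measure (U \<Otimes>\<^sub>M U) (sym_diff C (labset U f E)) + measure (U \<Otimes>\<^sub>M U) (sym_diff D (labset U g F))"
    by (rule measure_Un_le) auto
  also have "\<dots> < e" using f g by simp
  finally show "\<exists>lb E. labelling U lb \<and> measure (U \<Otimes>\<^sub>M U) (sym_diff (C \<union> D) (labset U lb E)) < e"
    using lb by blast
qed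

lemma approximable_empty: "approximable U {}"
  unfolding approximable_def
proof (intro allI impI exI conjI)
  fix e :: real assume "e > 0"
  show "labelling U (\<lambda>_. 0)"
    by (auto simp: labelling_def intro: finite_subset[of _ "{0}"])
  have "sym_diff {} (labset U (\<lambda>_. 0) {}) = {}" by (simp add: labset_def)
  then show "measure (U \<Otimes>\<^sub>M U) (sym_diff {} (labset U (\<lambda>_. 0) {})) < e"
    using \<open>e > 0\<close> by (simp only: measure_empty)
qed

text \<open>Continuity from below replaces the countable union by a finite one at cost
  \<open>e / 2\<close>; finite unions follow by induction from the binary case.\<close>

lemma approximable_UN:
  assumes U: "finite_measure U" and C: "\<And>i. C i \<in> sets (U \<Otimes>\<^sub>M U)"
    and ap: "\<And>i::nat. approximable U (C i)"
  shows "approximable U (\<Union>i. C i)"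
  unfolding approximable_def
proof (intro allI impI)
  interpret UU: finite_measure "U \<Otimes>\<^sub>M U" using U by (rule finite_measure_pair)
  fix e :: real assume e: "e > 0"
  define D where "D m = (\<Union>i<m. C i)" for m
  note C[measurable]
  have D[measurable]: "D m \<in> sets (U \<Otimes>\<^sub>M U)" for m unfolding D_def by measurable
  have apD: "approximable U (D m)" for m
  proof (induction m)
    case 0
    then show ?case by (simp add: D_def approximable_empty)
  next
    case (Suc m)
    have "D (Suc m) = D m \<union> C m" by (auto simp: D_def less_Suc_eq)
    then show ?case using approximable_Un[OF U D C Suc ap] by simp
  qed
  have UD: "(\<Union>m. D m) = (\<Union>i. C i)" by (auto simp: D_def)
  have "(\<lambda>m. measure (U \<Otimes>\<^sub>M U) (D m)) \<longlonglongrightarrow> measure (U \<Otimes>\<^sub>M U) (\<Union>m. D m)"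
    by (rule UU.finite_Lim_measure_incseq) (auto intro!: incseq_SucI simp: D_def less_Suc_eq)
  then have "\<forall>\<^sub>F m in sequentially. measure (U \<Otimes>\<^sub>M U) (\<Union>m. D m) - e / 2 < measure (U \<Otimes>\<^sub>M U) (D m)"
    using e by (intro order_tendstoD) auto
  then obtain m where m: "measure (U \<Otimes>\<^sub>M U) (\<Union>i. C i) - e / 2 < measure (U \<Otimes>\<^sub>M U) (D m)"
    unfolding UD by (auto simp: eventually_sequentially)
  have sub: "D m \<subseteq> (\<Union>i. C i)" by (auto simp: D_def)
  obtain lb E where lb: "labelling U lb" "measure (U \<Otimes>\<^sub>M U) (sym_diff (D m) (labset U lb E)) < e / 2"
    using apD[of m] e unfolding approximable_def by (meson half_gt_zero)
  have [measurable]: "labset U lb E \<in> sets (U \<Otimes>\<^sub>M U)" using lb by (auto intro: sets_labset)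
  have "measure (U \<Otimes>\<^sub>M U) (sym_diff (\<Union>i. C i) (labset U lb E))
      \<le> measure (U \<Otimes>\<^sub>M U) (((\<Union>i. C i) - D m) \<union> sym_diff (D m) (labset U lb E))"
    by (intro UU.finite_measure_mono) (use sub in auto)
  also have "\<dots> \<le> measure (U \<Otimes>\<^sub>M U) ((\<Union>i. C i) - D m) + measure (U \<Otimes>\<^sub>M U) (sym_diff (D m) (labset U lb E))"
    by (rule measure_Un_le) auto
  also have "measure (U \<Otimes>\<^sub>M U) ((\<Union>i. C i) - D m) = measure (U \<Otimes>\<^sub>M U) (\<Union>i. C i) - measure (U \<Otimes>\<^sub>M U) (D m)"
    by (rule UU.finite_measure_Diff) (use sub in auto)
  finally show "\<exists>lb E. labelling U lb \<and> measure (U \<Otimes>\<^sub>M U) (sym_diff (\<Union>i. C i) (labset U lb E)) < e"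
    using lb m by (intro exI[of _ lb] exI[of _ E]) auto
qed

lemma approximable_rectangle:
  assumes "A \<in> sets U" "B \<in> sets U"
  shows "approximable U (A \<times> B)"
  unfolding approximable_def
proof (intro allI impI)
  fix e :: real assume e: "e > 0"
  \<comment> \<open>A binary code: membership in \<open>A\<close> contributes \<open>1\<close> and
    membership in \<open>B\<close> contributes \<open>2\<close>, so labels \<open>1, 3\<close> mark
    \<open>A\<close> and labels \<open>2, 3\<close> mark \<open>B\<close>.\<close>
  define lb :: "'a \<Rightarrow> nat" where "lb x = (if x \<in> A then 1 else 0) + (if x \<in> B then 2 else 0)" for x
  note assms[measurable]
  have "lb \<in> measurable U (count_space UNIV)" unfolding lb_def by measurable
  moreover have "lb ` space U \<subseteq> {..3}" by (auto simp: lb_def)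
  then have "finite (lb ` space U)" by (rule finite_subset) simp
  ultimately have "labelling U lb" by (simp add: labelling_def)
  moreover have "labset U lb ({1, 3} \<times> {2, 3}) = A \<times> B"
    using assms[THEN sets.sets_into_space]
    by (auto simp: labset_def lb_def space_pair_measure split: if_splits)
  ultimately show "\<exists>lb E. labelling U lb \<and> measure (U \<Otimes>\<^sub>M U) (sym_diff (A \<times> B) (labset U lb E)) < e"
    using e by (intro exI[of _ lb] exI[of _ "{1, 3} \<times> {2, 3}"]) simp
qed

text \<open>Approximability holds for rectangles and survives complements and countable unions,
  hence holds on the sigma-algebra they generate.\<close>

lemma approximable_sets:
  assumes U: "finite_measure U" and C: "C \<in> sets (U \<Otimes>\<^sub>M U)"
  shows "approximable U C"
  using C unfolding sets_pair_measure
proof (induction rule: sigma_sets.induct)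
  case (Basic a)
  then show ?case by (auto intro: approximable_rectangle)
next
  case Empty
  then show ?case by (rule approximable_empty)
next
  case (Compl a)
  then have "a \<in> sets (U \<Otimes>\<^sub>M U)" by (simp add: sets_pair_measure)
  then show ?case
    using approximable_compl[OF sets.sets_into_space Compl(2)] by (simp add: space_pair_measure)
next
  case (Union a)
  then show ?case by (intro approximable_UN U) (auto simp: sets_pair_measure)
qed

lemma measure_pair_swap:
  assumes U: "finite_measure U" and C: "C \<in> sets (U \<Otimes>\<^sub>M U)"
  shows "measure (U \<Otimes>\<^sub>M U) {p \<in> space (U \<Otimes>\<^sub>M U). prod.swap p \<in> C} = measure (U \<Otimes>\<^sub>M U) C"
    and "{p \<in> space (U \<Otimes>\<^sub>M U). prod.swap p \<in> C} \<in> sets (U \<Otimes>\<^sub>M U)"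
proof -
  interpret finite_measure U by fact
  interpret pair_sigma_finite U U ..
  have m: "(\<lambda>(x, y). (y, x)) \<in> measurable (U \<Otimes>\<^sub>M U) (U \<Otimes>\<^sub>M U)" by measurable
  have eq: "{p \<in> space (U \<Otimes>\<^sub>M U). prod.swap p \<in> C} = (\<lambda>(x, y). (y, x)) -` C \<inter> space (U \<Otimes>\<^sub>M U)"
    by auto
  show "{p \<in> space (U \<Otimes>\<^sub>M U). prod.swap p \<in> C} \<in> sets (U \<Otimes>\<^sub>M U)"
    unfolding eq using m C by (rule measurable_sets)
  have "measure (U \<Otimes>\<^sub>M U) C = measure (distr (U \<Otimes>\<^sub>M U) (U \<Otimes>\<^sub>M U) (\<lambda>(x, y). (y, x))) C"
    by (subst distr_pair_swap) simp
  also have "\<dots> = measure (U \<Otimes>\<^sub>M U) {p \<in> space (U \<Otimes>\<^sub>M U). prod.swap p \<in> C}"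
    unfolding eq by (rule measure_distr[OF m C])
  finally show "measure (U \<Otimes>\<^sub>M U) {p \<in> space (U \<Otimes>\<^sub>M U). prod.swap p \<in> C} = measure (U \<Otimes>\<^sub>M U) C" ..
qed

lemma diffuse_symmetric_approximation:
  assumes U: "finite_measure U" "diffuse U" and C: "C \<in> sets (U \<Otimes>\<^sub>M U)" "sym C" and e: "e > 0"
  obtains lb E where "labelling U lb" "sym E" "irrefl E"
    "measure (U \<Otimes>\<^sub>M U) (sym_diff C (labset U lb E)) < e"
proof -
  interpret UU: finite_measure "U \<Otimes>\<^sub>M U" using U(1) by (rule finite_measure_pair)
  have e3: "e / 3 > 0" using e by simp
  obtain f E where f: "labelling U f" "measure (U \<Otimes>\<^sub>M U) (sym_diff C (labset U f E)) < e / 3"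
    using approximable_sets[OF U(1) C(1)] e3 unfolding approximable_def by blast
  obtain g where g: "labelling U g" "measure (U \<Otimes>\<^sub>M U) (labset U g Id) < e / 3"
    using U(2) e3 unfolding diffuse_def by blast
  define lb where "lb x = prod_encode (f x, g x)" for x
  \<comment> \<open>A pair is kept only if it lies in \<open>E\<close> in both orders and
    \<open>g\<close> separates its entries; this forces symmetry and irreflexivity.\<close>
  define G where "G = {(i, j). (fst (prod_decode i), fst (prod_decode j)) \<in> E
      \<and> (fst (prod_decode j), fst (prod_decode i)) \<in> E \<and> snd (prod_decode i) \<noteq> snd (prod_decode j)}"
  have lb: "labelling U lb" unfolding lb_def by (rule labelling_prod_encode) fact+
  have [measurable]: "labset U f E \<in> sets (U \<Otimes>\<^sub>M U)" "labset U g Id \<in> sets (U \<Otimes>\<^sub>M U)"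
    using f g by (auto intro: sets_labset)
  note C(1)[measurable]
  define S where "S = sym_diff C (labset U f E)"
  have S[measurable]: "S \<in> sets (U \<Otimes>\<^sub>M U)" unfolding S_def by measurable
  define T where "T = {p \<in> space (U \<Otimes>\<^sub>M U). prod.swap p \<in> S}"
  have T[measurable]: "T \<in> sets (U \<Otimes>\<^sub>M U)" and TS: "measure (U \<Otimes>\<^sub>M U) T = measure (U \<Otimes>\<^sub>M U) S"
    unfolding T_def using measure_pair_swap[OF U(1) S] by auto
  \<comment> \<open>As \<open>C\<close> is symmetric, a pair misclassified by \<open>G\<close> is
    misclassified by \<open>E\<close>, or its transpose is, or \<open>g\<close> does not separate
    it. Each case has measure below \<open>e / 3\<close>.\<close>
  have "sym_diff C (labset U lb G) \<subseteq> (S \<union> T) \<union> labset U g Id"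
    using C(2) sets.sets_into_space[OF C(1)]
    by (auto simp: S_def T_def labset_def lb_def G_def space_pair_measure dest: symD)
  then have "measure (U \<Otimes>\<^sub>M U) (sym_diff C (labset U lb G)) \<le> measure (U \<Otimes>\<^sub>M U) ((S \<union> T) \<union> labset U g Id)"
    by (intro UU.finite_measure_mono) auto
  also have "\<dots> \<le> measure (U \<Otimes>\<^sub>M U) (S \<union> T) + measure (U \<Otimes>\<^sub>M U) (labset U g Id)"
    by (rule measure_Un_le) auto
  also have "measure (U \<Otimes>\<^sub>M U) (S \<union> T) \<le> measure (U \<Otimes>\<^sub>M U) S + measure (U \<Otimes>\<^sub>M U) T"
    by (rule measure_Un_le) auto
  finally have "measure (U \<Otimes>\<^sub>M U) (sym_diff C (labset U lb G)) < e"
    using f g TS unfolding S_def by simp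
  moreover have "sym G" "irrefl G" by (auto simp: G_def sym_def irrefl_def)
  ultimately show thesis using that lb by blast
qed

section \<open>Pair counts of a Poisson process\<close>

text \<open>The set is the support of a product \<open>pmf\<close>, hence countable. Laws
  concentrated on it are determined by single points although the type of all sequences is
  uncountable.\<close>

lemma countable_eventually_zero: "countable {y :: nat \<Rightarrow> nat. \<forall>i\<ge>n. y i = 0}"
proof -
  have "set_pmf (Pi_pmf {..<n} 0 (\<lambda>_. poisson_pmf 1)) = {y. \<forall>i\<ge>n. y i = 0}"
    by (subst set_Pi_pmf) (auto simp: PiE_dflt_def not_less)
  then show ?thesis using countable_set_pmf by metis
qed

text \<open>All values of \<open>Y\<close> lie in a countable set, so measurability and law reduce
  to single vectors, where independence gives the product of the \<open>pmf\<close> values.\<close>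

lemma (in prob_space) indep_vars_nat_Pi_pmf:
  fixes X :: "nat \<Rightarrow> 'a \<Rightarrow> nat"
  assumes X: "indep_vars (\<lambda>_. count_space UNIV) X {..<n}"
    and p: "\<And>i k. i < n \<Longrightarrow> prob {\<omega> \<in> space M. X i \<omega> = k} = pmf (p i) k"
    and Y: "\<And>\<omega> i. Y \<omega> i = (if i < n then X i \<omega> else 0)"
  shows "Y \<in> measurable M (count_space UNIV)"
    and "distr M (count_space UNIV) Y = measure_pmf (Pi_pmf {..<n} 0 p)"
proof -
  let ?S = "{y :: nat \<Rightarrow> nat. \<forall>i\<ge>n. y i = 0}"
  have Xm: "X i \<in> measurable M (count_space UNIV)" if "i < n" for i
    using X that unfolding indep_vars_def by auto
  have X1: "{\<omega> \<in> space M. X i \<omega> = k} \<in> events" if "i < n" for i k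
    using measurable_sets[OF Xm[OF that], of "{k}"] by (simp add: vimage_def Int_def conj_commute)
  have single: "Y -` {y} \<inter> space M = {\<omega> \<in> space M. \<forall>i\<in>{..<n}. X i \<omega> = y i}" if "y \<in> ?S" for y
    using that by (auto simp: Y fun_eq_iff)
  have sets1: "{\<omega> \<in> space M. \<forall>i\<in>{..<n}. X i \<omega> = y i} \<in> events" for y
    using X1 by (intro sets.sets_Collect_finite_All) auto
  have YS: "Y \<omega> \<in> ?S" for \<omega> by (simp add: Y)
  show Ym: "Y \<in> measurable M (count_space UNIV)"
  proof (rule measurableI)
    fix A :: "(nat \<Rightarrow> nat) set"
    have "Y -` A \<inter> space M = (\<Union>y\<in>A \<inter> ?S. Y -` {y} \<inter> space M)" using YS by auto
    also have "\<dots> \<in> events"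
      by (intro sets.countable_UN') (auto simp: single sets1 countable_eventually_zero)
    finally show "Y -` A \<inter> space M \<in> events" .
  qed simp
  show "distr M (count_space UNIV) Y = measure_pmf (Pi_pmf {..<n} 0 p)"
  proof (rule measure_eqI_countable_AE[where \<Omega> = ?S])
    show "AE y in distr M (count_space UNIV) Y. y \<in> ?S"
      using YS Ym by (subst AE_distr_iff) auto
    show "AE y in measure_pmf (Pi_pmf {..<n} 0 p). y \<in> ?S"
      using set_Pi_pmf_subset[of "{..<n}" 0 p] by (auto simp: AE_measure_pmf_iff not_less)
    fix y assume y: "y \<in> ?S"
    have "prob {\<omega> \<in> space M. \<forall>i\<in>{..<n}. X i \<omega> = y i} = (\<Prod>i<n. pmf (p i) (y i))"
    \<comment> \<open>An intersection over no indices is the whole type rather than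
      \<open>space M\<close>, so \<open>n = 0\<close> is treated apart.\<close>
    proof (cases "n = 0")
      case True
      then show ?thesis by (simp add: prob_space)
    next
      case False
      have "{\<omega> \<in> space M. \<forall>i\<in>{..<n}. X i \<omega> = y i} = (\<Inter>i\<in>{..<n}. X i -` {y i} \<inter> space M)"
        using False by auto
      then have "prob {\<omega> \<in> space M. \<forall>i\<in>{..<n}. X i \<omega> = y i} = (\<Prod>i<n. prob (X i -` {y i} \<inter> space M))"
        using indep_varsD_finite[OF X, of "\<lambda>i. {y i}"] False by auto
      also have "\<dots> = (\<Prod>i<n. pmf (p i) (y i))"
        using p by (intro prod.cong) (auto simp: vimage_def Int_def conj_commute)
      finally show ?thesis .
    qed
    also have "\<dots> = pmf (Pi_pmf {..<n} 0 p) y" using y by (subst pmf_Pi') auto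
    finally show "emeasure (distr M (count_space UNIV) Y) {y} = emeasure (measure_pmf (Pi_pmf {..<n} 0 p)) {y}"
      using Ym y by (simp add: emeasure_distr single emeasure_eq_measure emeasure_pmf_single)
  qed (use countable_eventually_zero in auto)
qed

text \<open>A pair and its transpose are removed together. Applied to off-diagonal pairs of points,
  it makes halving the pair count exact.\<close>

lemma even_card_sym_irrefl:
  assumes "finite R" "sym R" "irrefl R"
  shows "even (card R)"
  using assms
proof (induction R rule: finite_psubset_induct)
  case (psubset R)
  show ?case
  proof (cases "R = {}")
    case False
    then obtain x y where xy: "(x, y) \<in> R" by auto
    then have yx: "(y, x) \<in> R" "x \<noteq> y" using psubset.prems by (auto dest: symD simp: irrefl_def)
    let ?R = "R - {(x, y), (y, x)}"
    have "even (card ?R)"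
    proof (rule psubset.IH)
      show "?R \<subset> R" using xy by auto
      show "sym ?R" "irrefl ?R" using psubset.prems by (auto simp: sym_def irrefl_def)
    qed
    moreover have "card (?R \<union> {(x, y), (y, x)}) = card ?R + card {(x, y), (y, x)}"
      using psubset.hyps by (intro card_Un_disjoint) auto
    moreover have "?R \<union> {(x, y), (y, x)} = R" using xy yx by auto
    ultimately show ?thesis using yx by (simp del: Un_insert_right)
  qed simp
qed

section \<open>Abstract Poisson points and their second factorial moment measure\<close>

text \<open>The rate is absorbed into the finite measure \<open>U\<close>, and the geometry is
  abstracted away: only a finite random set with independent Poisson counts remains.\<close>

locale poisson_points = prob_space M + U: finite_measure U
  for M :: "'b measure" and U :: "'a measure" +
  fixes P :: "'b \<Rightarrow> 'a set"
  assumes finite_P: "\<omega> \<in> space M \<Longrightarrow> finite (P \<omega>)"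
    and P_space: "\<omega> \<in> space M \<Longrightarrow> P \<omega> \<subseteq> space U"
    and count_law: "A \<in> sets U \<Longrightarrow>
      prob {\<omega> \<in> space M. card (P \<omega> \<inter> A) = k} = measure U A ^ k / fact k * exp (- measure U A)"
    and count_indep: "\<forall>i<(n::nat). As i \<in> sets U \<Longrightarrow> disjoint_family_on As {..<n} \<Longrightarrow>
      indep_vars (\<lambda>_. count_space UNIV) (\<lambda>i \<omega>. card (P \<omega> \<inter> As i)) {..<n}"
begin

definition off_diag :: "('a \<times> 'a) set \<Rightarrow> 'b \<Rightarrow> ('a \<times> 'a) set" where
  "off_diag C \<omega> = {p \<in> P \<omega> \<times> P \<omega>. fst p \<noteq> snd p \<and> p \<in> C}"

definition pairs :: "('a \<times> 'a) set \<Rightarrow> 'b \<Rightarrow> nat" where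
  "pairs C \<omega> = card (off_diag C \<omega>)"

lemma finite_off_diag: "\<omega> \<in> space M \<Longrightarrow> finite (off_diag C \<omega>)"
  by (rule finite_subset[of _ "P \<omega> \<times> P \<omega>"]) (auto simp: off_diag_def finite_P)

lemma counts_joint_law:
  assumes "\<forall>i<(n::nat). As i \<in> sets U" "disjoint_family_on As {..<n}"
    and Y: "Y = (\<lambda>\<omega> i. if i < n then card (P \<omega> \<inter> As i) else 0)"
  shows "Y \<in> measurable M (count_space UNIV)"
    and "distr M (count_space UNIV) Y = measure_pmf (Pi_pmf {..<n} 0 (\<lambda>i. poisson0_pmf (measure U (As i))))"
proof -
  have p: "prob {\<omega> \<in> space M. card (P \<omega> \<inter> As i) = k} = pmf (poisson0_pmf (measure U (As i))) k"
    if "i < n" for i k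
    using that assms(1) by (simp add: count_law pmf_poisson0)
  have Y': "Y \<omega> i = (if i < n then card (P \<omega> \<inter> As i) else 0)" for \<omega> i by (simp add: Y)
  note * = indep_vars_nat_Pi_pmf[OF count_indep[OF assms(1,2)], of "\<lambda>i. poisson0_pmf (measure U (As i))", OF p Y']
  show "Y \<in> measurable M (count_space UNIV)"
    and "distr M (count_space UNIV) Y = measure_pmf (Pi_pmf {..<n} 0 (\<lambda>i. poisson0_pmf (measure U (As i))))"
    using * by simp_all
qed

text \<open>Cutting into \<open>A \<inter> B\<close>, \<open>A - B\<close> and \<open>B - A\<close>
  makes the count a polynomial in independent Poisson variables. Dropping the diagonal leaves
  \<open>y 0 * (y 0 - 1)\<close>, with mean \<open>a 0 * a 0\<close>, so exactly the product measure
  results.\<close>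

lemma pairs_rectangle:
  assumes A: "A \<in> sets U" "B \<in> sets U"
  shows "(\<lambda>\<omega>. of_nat (pairs (A \<times> B) \<omega>) :: ennreal) \<in> borel_measurable M"
    and "(\<integral>\<^sup>+\<omega>. of_nat (pairs (A \<times> B) \<omega>) \<partial>M) = emeasure (U \<Otimes>\<^sub>M U) (A \<times> B)"
proof -
  define As where "As i = (if i = 0 then A \<inter> B else if i = 1 then A - B else B - A)" for i :: nat
  define Y where "Y = (\<lambda>\<omega> i. if i < (3::nat) then card (P \<omega> \<inter> As i) else 0)"
  define a where "a i = measure U (As i)" for i
  define Q where "Q = Pi_pmf {..<3::nat} 0 (\<lambda>i. poisson0_pmf (a i))"
  \<comment> \<open>This is \<open>(y 0 + y 1) * (y 0 + y 2)\<close> with the \<open>y 0\<close>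
    diagonal pairs removed.\<close>
  define h :: "(nat \<Rightarrow> nat) \<Rightarrow> nat" where
    "h y = y 0 * (y 0 - 1) + y 0 * y 2 + y 1 * y 0 + y 1 * y 2" for y
  have As: "As i \<in> sets U" for i using A by (auto simp: As_def)
  then have As': "\<forall>i<3. As i \<in> sets U" by simp
  have dis: "disjoint_family_on As {..<3}" by (auto simp: disjoint_family_on_def As_def)
  have Ym: "Y \<in> measurable M (count_space UNIV)"
    and YQ: "distr M (count_space UNIV) Y = measure_pmf Q"
    using counts_joint_law[OF As' dis Y_def] by (auto simp: Q_def a_def)
  have pairs: "pairs (A \<times> B) \<omega> = h (Y \<omega>)" if w: "\<omega> \<in> space M" for \<omega>
  proof -
    note fin = finite_P[OF w]
    let ?D = "(\<lambda>x. (x, x)) ` (P \<omega> \<inter> (A \<inter> B))"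
    have "off_diag (A \<times> B) \<omega> = (P \<omega> \<inter> A) \<times> (P \<omega> \<inter> B) - ?D"
      by (auto simp: off_diag_def)
    then have "pairs (A \<times> B) \<omega> = card ((P \<omega> \<inter> A) \<times> (P \<omega> \<inter> B)) - card ?D"
      using fin unfolding pairs_def by (simp only:) (subst card_Diff_subset, auto)
    also have "card ?D = Y \<omega> 0" by (subst card_image) (auto simp: inj_on_def Y_def As_def)
    also have "card ((P \<omega> \<inter> A) \<times> (P \<omega> \<inter> B)) = card (P \<omega> \<inter> A) * card (P \<omega> \<inter> B)"
      by (rule card_cartesian_product)
    also have "card (P \<omega> \<inter> A) = Y \<omega> 0 + Y \<omega> 1"
      using fin unfolding Y_def As_def
      by (simp, subst card_Un_disjoint[symmetric]) (auto intro!: arg_cong[of _ _ card])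
    also have "card (P \<omega> \<inter> B) = Y \<omega> 0 + Y \<omega> 2"
      using fin unfolding Y_def As_def
      by (simp, subst card_Un_disjoint[symmetric]) (auto intro!: arg_cong[of _ _ card])
    finally show ?thesis
      by (cases "Y \<omega> 0") (simp_all add: h_def algebra_simps)
  qed
  have "(\<lambda>\<omega>. of_nat (h (Y \<omega>)) :: ennreal) \<in> borel_measurable M"
    using Ym by (rule measurable_compose) simp
  then show "(\<lambda>\<omega>. of_nat (pairs (A \<times> B) \<omega>) :: ennreal) \<in> borel_measurable M"
    by (subst measurable_cong[where g = "\<lambda>\<omega>. of_nat (h (Y \<omega>))"]) (auto simp: pairs)
  have an: "a i \<ge> 0" for i by (simp add: a_def)
  note mecke = nn_integral_Pi_poisson0_mecke[OF _ an Q_def, simplified]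
  have e1: "(\<integral>\<^sup>+y. of_nat (y i) \<partial>Q) = ennreal (a i)" if "i < 3" for i
    using mecke[OF that, of "\<lambda>_. 1"] by simp
  have e2: "(\<integral>\<^sup>+y. of_nat (y i) * of_nat (y j) \<partial>Q) = ennreal (a i) * ennreal (a j)"
    if "i < 3" "j < 3" "i \<noteq> j" for i j
    using mecke[OF that(1), of "\<lambda>y. of_nat (y j)"] e1[OF that(2)] that(3) by (simp add: incr_def)
  have e3: "(\<integral>\<^sup>+y. of_nat (y 0) * of_nat (y 0 - 1) \<partial>Q) = ennreal (a 0) * ennreal (a 0)"
    using mecke[of 0 "\<lambda>y. of_nat (y 0 - 1)"] e1[of 0] by (simp add: incr_def)
  have "(\<integral>\<^sup>+\<omega>. of_nat (pairs (A \<times> B) \<omega>) \<partial>M) = (\<integral>\<^sup>+\<omega>. of_nat (h (Y \<omega>)) \<partial>M)"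
    by (rule nn_integral_cong) (simp add: pairs)
  also have "\<dots> = (\<integral>\<^sup>+y. of_nat (h y) \<partial>Q)"
    unfolding YQ[symmetric] using Ym by (subst nn_integral_distr) auto
  also have "\<dots> = ennreal (a 0) * ennreal (a 0) + ennreal (a 0) * ennreal (a 2)
      + ennreal (a 1) * ennreal (a 0) + ennreal (a 1) * ennreal (a 2)"
    by (simp add: h_def nn_integral_add e2 e3[unfolded One_nat_def])
  also have "\<dots> = (ennreal (a 0) + ennreal (a 1)) * (ennreal (a 0) + ennreal (a 2))"
    by (simp add: algebra_simps)
  also have "ennreal (a 0) + ennreal (a 1) = emeasure U A"
    unfolding a_def U.emeasure_eq_measure[symmetric] using As[of 0] As[of 1]
    by (subst plus_emeasure) (auto simp: As_def intro!: arg_cong[of _ _ "emeasure U"])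
  also have "ennreal (a 0) + ennreal (a 2) = emeasure U B"
    unfolding a_def U.emeasure_eq_measure[symmetric] using As[of 0] As[of 2]
    by (subst plus_emeasure) (auto simp: As_def intro!: arg_cong[of _ _ "emeasure U"])
  finally show "(\<integral>\<^sup>+\<omega>. of_nat (pairs (A \<times> B) \<omega>) \<partial>M) = emeasure (U \<Otimes>\<^sub>M U) (A \<times> B)"
    using A by (simp add: U.emeasure_pair_measure_Times)
qed

text \<open>The summation set does not depend on \<open>C\<close>, so countable additivity of the
  count in \<open>C\<close> is inherited from indicators.\<close>

lemma pairs_eq_sum:
  assumes "\<omega> \<in> space M"
  shows "(of_nat (pairs C \<omega>) :: ennreal) = (\<Sum>p\<in>off_diag UNIV \<omega>. indicator C p)"
proof -
  have "off_diag C \<omega> = off_diag UNIV \<omega> \<inter> C" by (auto simp: off_diag_def)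
  then show ?thesis
    using finite_off_diag[OF assms] by (simp add: pairs_def sum_indicator_eq_card[symmetric] indicator_def sum.If_cases Int_def)
qed

text \<open>A Dynkin argument starting from rectangles, with measurability and mean carried
  together. Complements are subtracted from the full square; disjoint unions use summation under the
  integral.\<close>

lemma pairs_nn_integral:
  assumes C: "C \<in> sets (U \<Otimes>\<^sub>M U)"
  shows "(\<lambda>\<omega>. of_nat (pairs C \<omega>) :: ennreal) \<in> borel_measurable M \<and>
     (\<integral>\<^sup>+\<omega>. of_nat (pairs C \<omega>) \<partial>M) = emeasure (U \<Otimes>\<^sub>M U) C"
proof -
  interpret UU: finite_measure "U \<Otimes>\<^sub>M U" by (rule finite_measure_pair) unfold_locales
  let ?G = "{a \<times> b |a b. a \<in> sets U \<and> b \<in> sets U}" and ?S = "space U \<times> space U"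
  have S: "?S = space (U \<Otimes>\<^sub>M U)" by (simp add: space_pair_measure)
  have C': "C \<in> sigma_sets ?S ?G" using C by (simp add: sets_pair_measure)
  have "Int_stable ?G"
    by (rule Int_stable_pair_measure_generator)
  moreover have "?G \<subseteq> Pow ?S" using sets.sets_into_space by blast
  ultimately show ?thesis using C'
  proof (induction rule: sigma_sets_induct_disjoint)
    case (basic A)
    then show ?case using pairs_rectangle by auto
  next
    case empty
    then show ?case by (simp add: pairs_def off_diag_def)
  next
    case (compl A)
    then have A: "A \<in> sets (U \<Otimes>\<^sub>M U)" by (simp add: sets_pair_measure)
    have Ap: "(\<lambda>\<omega>. of_nat (pairs A \<omega>) :: ennreal) \<in> borel_measurable M"
      "(\<integral>\<^sup>+\<omega>. of_nat (pairs A \<omega>) \<partial>M) = emeasure (U \<Otimes>\<^sub>M U) A" using compl by auto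
    have Sp: "(\<lambda>\<omega>. of_nat (pairs ?S \<omega>) :: ennreal) \<in> borel_measurable M"
      "(\<integral>\<^sup>+\<omega>. of_nat (pairs ?S \<omega>) \<partial>M) = emeasure (U \<Otimes>\<^sub>M U) ?S"
      using pairs_rectangle[of "space U" "space U"] by auto
    have sum: "pairs ?S \<omega> = pairs (?S - A) \<omega> + pairs A \<omega>" if "\<omega> \<in> space M" for \<omega>
    proof -
      have "off_diag ?S \<omega> = off_diag (?S - A) \<omega> \<union> off_diag A \<omega>"
        using sets.sets_into_space[OF A] by (auto simp: off_diag_def space_pair_measure)
      then show ?thesis unfolding pairs_def
        by (simp only:) (intro card_Un_disjoint finite_off_diag that, auto simp: off_diag_def)
    qed
    have "(\<lambda>\<omega>. of_nat (pairs ?S \<omega>) - of_nat (pairs A \<omega>) :: ennreal) \<in> borel_measurable M"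
      using Ap Sp by measurable
    then have m: "(\<lambda>\<omega>. of_nat (pairs (?S - A) \<omega>) :: ennreal) \<in> borel_measurable M"
      by (subst measurable_cong[where g = "\<lambda>\<omega>. of_nat (pairs ?S \<omega>) - of_nat (pairs A \<omega>)"])
        (auto simp: sum)
    have "(\<integral>\<^sup>+\<omega>. of_nat (pairs (?S - A) \<omega>) \<partial>M) + (\<integral>\<^sup>+\<omega>. of_nat (pairs A \<omega>) \<partial>M)
        = (\<integral>\<^sup>+\<omega>. of_nat (pairs ?S \<omega>) \<partial>M)"
      using Ap(1) m by (subst nn_integral_add[symmetric]) (auto intro!: nn_integral_cong simp: sum)
    also have "\<dots> = emeasure (U \<Otimes>\<^sub>M U) (?S - A) + emeasure (U \<Otimes>\<^sub>M U) A"
      using A sets.sets_into_space[OF A] unfolding Sp(2) unfolding S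
      by (subst plus_emeasure) (auto intro!: arg_cong2[of _ _ _ _ emeasure])
    \<comment> \<open>The contribution of \<open>A\<close> may be cancelled because its product
      measure is finite.\<close>
    finally have "(\<integral>\<^sup>+\<omega>. of_nat (pairs (?S - A) \<omega>) \<partial>M) = emeasure (U \<Otimes>\<^sub>M U) (?S - A)"
      unfolding Ap(2) by (simp add: UU.emeasure_eq_measure)
    then show ?case using m by simp
  next
    case (union A)
    then have A: "range A \<subseteq> sets (U \<Otimes>\<^sub>M U)" by (simp add: sets_pair_measure)
    have eq: "(of_nat (pairs (\<Union>i. A i) \<omega>) :: ennreal) = (\<Sum>i. of_nat (pairs (A i) \<omega>))"
      if "\<omega> \<in> space M" for \<omega>
    proof -
      have "(\<Sum>i. of_nat (pairs (A i) \<omega>) :: ennreal) = (\<Sum>i. \<Sum>p\<in>off_diag UNIV \<omega>. indicator (A i) p)"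
        using that by (simp add: pairs_eq_sum)
      also have "\<dots> = (\<Sum>p\<in>off_diag UNIV \<omega>. \<Sum>i. indicator (A i) p)"
        by (rule suminf_sum) auto
      also have "\<dots> = (of_nat (pairs (\<Union>i. A i) \<omega>) :: ennreal)"
        using that union(1) by (simp add: pairs_eq_sum suminf_indicator)
      finally show ?thesis ..
    qed
    have m: "(\<lambda>\<omega>. of_nat (pairs (A i) \<omega>) :: ennreal) \<in> borel_measurable M" for i
      using union by auto
    have "(\<lambda>\<omega>. \<Sum>i. of_nat (pairs (A i) \<omega>) :: ennreal) \<in> borel_measurable M"
      using m by measurable
    then have "(\<lambda>\<omega>. of_nat (pairs (\<Union>i. A i) \<omega>) :: ennreal) \<in> borel_measurable M"
      by (subst measurable_cong[OF eq]) auto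
    moreover have "(\<integral>\<^sup>+\<omega>. of_nat (pairs (\<Union>i. A i) \<omega>) \<partial>M) = (\<integral>\<^sup>+\<omega>. (\<Sum>i. of_nat (pairs (A i) \<omega>)) \<partial>M)"
      by (rule nn_integral_cong) (rule eq)
    moreover have "\<dots> = (\<Sum>i. emeasure (U \<Otimes>\<^sub>M U) (A i))"
      using union by (subst nn_integral_suminf) (auto simp: m)
    moreover have "\<dots> = emeasure (U \<Otimes>\<^sub>M U) (\<Union>i. A i)"
      using A union(1) by (rule suminf_emeasure)
    ultimately show ?case by simp
  qed
qed

lemma pairs_measurable:
  assumes C: "C \<in> sets (U \<Otimes>\<^sub>M U)"
  shows "pairs C \<in> measurable M (count_space UNIV)"
proof -
  have [measurable]: "(\<lambda>\<omega>. of_nat (pairs C \<omega>) :: ennreal) \<in> borel_measurable M"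
    using pairs_nn_integral[OF C] by simp
  have "(\<lambda>\<omega>. nat \<lfloor>enn2real (of_nat (pairs C \<omega>))\<rfloor>) \<in> measurable M (count_space UNIV)" by measurable
  then show ?thesis by (simp add: ennreal_of_nat_eq_real_of_nat)
qed

lemma pairs_expectation:
  assumes C: "C \<in> sets (U \<Otimes>\<^sub>M U)"
  shows "expectation (\<lambda>\<omega>. real (pairs C \<omega>)) = measure (U \<Otimes>\<^sub>M U) C"
proof -
  have [measurable]: "pairs C \<in> measurable M (count_space UNIV)" using C by (rule pairs_measurable)
  show ?thesis
    using pairs_nn_integral[OF C]
    by (subst integral_eq_nn_integral) (auto simp: measure_def ennreal_of_nat_eq_real_of_nat)
qed

text \<open>Markov's inequality for an integer count. Applied to a symmetric difference, it shows
  that nearby relations have equal pair counts outside an event of small probability.\<close>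

lemma pairs_markov:
  assumes C: "C \<in> sets (U \<Otimes>\<^sub>M U)"
  shows "prob {\<omega> \<in> space M. pairs C \<omega> \<noteq> 0} \<le> measure (U \<Otimes>\<^sub>M U) C"
proof -
  interpret UU: finite_measure "U \<Otimes>\<^sub>M U" by (rule finite_measure_pair) unfold_locales
  have [measurable]: "pairs C \<in> measurable M (count_space UNIV)" using C by (rule pairs_measurable)
  have "emeasure M {\<omega> \<in> space M. pairs C \<omega> \<noteq> 0} = (\<integral>\<^sup>+\<omega>. indicator {\<omega> \<in> space M. pairs C \<omega> \<noteq> 0} \<omega> \<partial>M)"
    by (subst nn_integral_indicator) auto
  also have "\<dots> \<le> (\<integral>\<^sup>+\<omega>. of_nat (pairs C \<omega>) \<partial>M)"
  proof (rule nn_integral_mono)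
    fix \<omega>
    have "of_nat 1 \<le> (of_nat (pairs C \<omega>) :: ennreal)" if "pairs C \<omega> \<noteq> 0"
      using that by (subst of_nat_le_iff) simp
    then show "indicator {\<omega> \<in> space M. pairs C \<omega> \<noteq> 0} \<omega> \<le> (of_nat (pairs C \<omega>) :: ennreal)"
      by (auto simp: indicator_def)
  qed
  finally show ?thesis
    using pairs_nn_integral[OF C] by (simp add: emeasure_eq_measure UU.emeasure_eq_measure)
qed

end

section \<open>Cell masses and expected degrees\<close>

definition cell :: "'a measure \<Rightarrow> ('a \<Rightarrow> nat) \<Rightarrow> nat \<Rightarrow> 'a set" where
  "cell U lb i = lb -` {i} \<inter> space U"

lemma sets_cell:
  assumes "labelling U lb"
  shows "cell U lb i \<in> sets U"
  using assms unfolding labelling_def cell_def by (auto intro: measurable_sets)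

lemma labset_eq_UN: "labset U lb E = (\<Union>(i, j)\<in>E. cell U lb i \<times> cell U lb j)"
  by (auto simp: labset_def cell_def space_pair_measure)

lemma (in finite_measure) measure_labset:
  assumes lb: "labelling M lb" and E: "finite E"
  shows "measure (M \<Otimes>\<^sub>M M) (labset M lb E)
    = (\<Sum>(i, j)\<in>E. measure M (cell M lb i) * measure M (cell M lb j))"
proof -
  interpret MM: finite_measure "M \<Otimes>\<^sub>M M" by (rule finite_measure_pair) unfold_locales
  have "measure (M \<Otimes>\<^sub>M M) (labset M lb E)
      = (\<Sum>e\<in>E. measure (M \<Otimes>\<^sub>M M) (case e of (i, j) \<Rightarrow> cell M lb i \<times> cell M lb j))"
    unfolding labset_eq_UN using E
    by (intro MM.finite_measure_finite_Union)
      (auto simp: disjoint_family_on_def cell_def intro!: pair_measureI sets_cell[OF lb, unfolded cell_def])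
  also have "\<dots> = (\<Sum>(i, j)\<in>E. measure M (cell M lb i) * measure M (cell M lb j))"
    using sets_cell[OF lb]
    by (intro sum.cong) (auto simp: measure_def emeasure_pair_measure_Times enn2real_mult)
  finally show ?thesis .
qed

text \<open>The expected degree of a label is the measure of the section through any point of its
  cell; this links the discrete Stein bound to sections of the relation.\<close>

lemma (in finite_measure) measure_labset_section:
  assumes lb: "labelling M lb" and E: "finite E" and x: "x \<in> space M"
  shows "measure M (Pair x -` labset M lb E) = nbs E (lb x) (\<lambda>i. measure M (cell M lb i))"
proof -
  have "Pair x -` labset M lb E = (\<Union>j\<in>E `` {lb x}. cell M lb j)"
    using x by (auto simp: labset_eq_UN cell_def)
  then show ?thesis
    unfolding nbs_def using E sets_cell[OF lb]
    by (simp only:) (intro finite_measure_finite_Union, auto simp: disjoint_family_on_def cell_def)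
qed

text \<open>The sum is the integral over the label set \<open>S\<close> of the section measure at
  the first coordinate. A section of \<open>S\<close> is covered by one of \<open>C\<close>, of
  measure at most \<open>k\<close>, and one of \<open>S - C\<close>. The latter is integrated over
  the whole product, where the free second coordinate yields the total mass.\<close>

lemma (in finite_measure) path_sum_bound:
  assumes lb: "labelling M lb" and E: "finite E" and C: "C \<in> sets (M \<Otimes>\<^sub>M M)"
    and k: "k \<ge> 0" "\<And>x. x \<in> space M \<Longrightarrow> measure M (Pair x -` C) \<le> k"
    and a: "a = (\<lambda>i. measure M (cell M lb i))"
  shows "(\<Sum>(i, j)\<in>E. a i * a j * nbs E i a)
    \<le> k * measure (M \<Otimes>\<^sub>M M) (labset M lb E) + measure M (space M) * measure (M \<Otimes>\<^sub>M M) (labset M lb E - C)"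
proof -
  interpret MM: finite_measure "M \<Otimes>\<^sub>M M" by (rule finite_measure_pair) unfold_locales
  define S where "S = labset M lb E"
  have S[measurable]: "S \<in> sets (M \<Otimes>\<^sub>M M)" unfolding S_def using lb by (rule sets_labset)
  note C[measurable]
  have SC[measurable]: "S - C \<in> sets (M \<Otimes>\<^sub>M M)" by measurable
  have a0: "a i \<ge> 0" for i by (simp add: a)
  have nb0: "nbs E i a \<ge> 0" for i unfolding nbs_def by (intro sum_nonneg a0)
  \<comment> \<open>Only the summand for the labels of \<open>p\<close> survives, so
    \<open>G\<close> is the expected degree at \<open>fst p\<close> on the label set and zero
    elsewhere.\<close>
  define G where "G p = (\<Sum>e\<in>E. ennreal (nbs E (fst e) a) * indicator (cell M lb (fst e) \<times> cell M lb (snd e)) p)" for p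
  have cells: "cell M lb i \<times> cell M lb j \<in> sets (M \<Otimes>\<^sub>M M)" for i j
    using sets_cell[OF lb] by auto
  have "ennreal (\<Sum>(i, j)\<in>E. a i * a j * nbs E i a) = (\<Sum>e\<in>E. ennreal (a (fst e) * a (snd e) * nbs E (fst e) a))"
    by (subst sum_ennreal[symmetric]) (auto simp: case_prod_unfold a0 nb0)
  also have "\<dots> = (\<Sum>e\<in>E. ennreal (nbs E (fst e) a) * emeasure (M \<Otimes>\<^sub>M M) (cell M lb (fst e) \<times> cell M lb (snd e)))"
    using sets_cell[OF lb] a0 nb0
    by (intro sum.cong) (auto simp: emeasure_pair_measure_Times emeasure_eq_measure a ennreal_mult[symmetric] mult_ac)
  also have "\<dots> = (\<integral>\<^sup>+p. G p \<partial>(M \<Otimes>\<^sub>M M))"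
    unfolding G_def using cells
    by (subst nn_integral_sum) (auto simp: nn_integral_cmult_indicator)
  also have "\<dots> \<le> (\<integral>\<^sup>+p. ennreal k * indicator S p + emeasure M (Pair (fst p) -` (S - C)) \<partial>(M \<Otimes>\<^sub>M M))"
  proof (rule nn_integral_mono)
    fix p assume "p \<in> space (M \<Otimes>\<^sub>M M)"
    then obtain x y where p: "p = (x, y)" "x \<in> space M" "y \<in> space M" by (auto simp: space_pair_measure)
    have ind: "indicator (cell M lb (fst e) \<times> cell M lb (snd e)) p = (if e = (lb x, lb y) then 1 else 0 :: ennreal)" for e
      using p by (auto simp: cell_def indicator_def)
    have G: "G p = (if (lb x, lb y) \<in> E then ennreal (nbs E (lb x) a) else 0)"
      unfolding G_def ind using E by (auto simp: if_distrib sum.delta' cong: if_cong)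
    show "G p \<le> ennreal k * indicator S p + emeasure M (Pair (fst p) -` (S - C))"
    proof (cases "(lb x, lb y) \<in> E")
      case True
      have [measurable]: "Pair x -` D \<in> sets M" if "D \<in> sets (M \<Otimes>\<^sub>M M)" for D
        using that by (rule sets_Pair1)
      have "nbs E (lb x) a = measure M (Pair x -` S)"
        unfolding S_def a using measure_labset_section[OF lb E p(2)] by simp
      also have "\<dots> \<le> measure M (Pair x -` C \<union> Pair x -` (S - C))"
        using C SC by (intro finite_measure_mono) auto
      also have "\<dots> \<le> measure M (Pair x -` C) + measure M (Pair x -` (S - C))"
        using C SC by (intro measure_Un_le) auto
      also have "\<dots> \<le> k + measure M (Pair x -` (S - C))" using k(2)[OF p(2)] by simp
      finally have "ennreal (nbs E (lb x) a) \<le> ennreal (k + measure M (Pair x -` (S - C)))"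
        by (rule ennreal_leI)
      also have "\<dots> = ennreal k + emeasure M (Pair x -` (S - C))"
        using k by (simp add: emeasure_eq_measure)
      moreover have "p \<in> S" using True p by (auto simp: S_def labset_def space_pair_measure)
      ultimately show ?thesis using G True p(1) by simp
    qed (simp add: G)
  qed
  also have "\<dots> = ennreal k * emeasure (M \<Otimes>\<^sub>M M) S
      + (\<integral>\<^sup>+p. emeasure M (Pair (fst p) -` (S - C)) \<partial>(M \<Otimes>\<^sub>M M))"
    using measurable_emeasure_Pair[OF SC]
    by (subst nn_integral_add) (auto simp: nn_integral_cmult_indicator)
  also have "(\<integral>\<^sup>+p. emeasure M (Pair (fst p) -` (S - C)) \<partial>(M \<Otimes>\<^sub>M M))
      = (\<integral>\<^sup>+x. \<integral>\<^sup>+y. emeasure M (Pair x -` (S - C)) \<partial>M \<partial>M)"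
    using measurable_emeasure_Pair[OF SC] by (subst nn_integral_fst[symmetric]) auto
  also have "\<dots> = emeasure (M \<Otimes>\<^sub>M M) (S - C) * emeasure M (space M)"
    using measurable_emeasure_Pair[OF SC]
    by (simp add: nn_integral_multc emeasure_pair_measure_alt[OF SC])
  finally have "ennreal (\<Sum>(i, j)\<in>E. a i * a j * nbs E i a)
    \<le> ennreal (k * measure (M \<Otimes>\<^sub>M M) S + measure M (space M) * measure (M \<Otimes>\<^sub>M M) (S - C))"
    using k by (simp add: MM.emeasure_eq_measure emeasure_eq_measure ennreal_mult ennreal_plus mult.commute)
  then show ?thesis
    unfolding S_def using k by (subst (asm) ennreal_le_iff) auto
qed

section \<open>Poisson approximation of pair counts\<close>

context poisson_points
begin

text \<open>Irreflexivity makes the two cells of a related pair disjoint, so their points are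
  automatically distinct and the counts multiply. The value \<open>0\<close> from \<open>n\<close>
  on matches the default of \<open>Pi_pmf\<close>.\<close>

lemma pairs_labset:
  assumes lb: "lb ` space U \<subseteq> {..<n}" and E: "finite E" "irrefl E" and w: "\<omega> \<in> space M"
  shows "pairs (labset U lb E) \<omega> = edges E (\<lambda>i. if i < n then card (P \<omega> \<inter> cell U lb i) else 0)"
proof -
  have "off_diag (labset U lb E) \<omega> = (\<Union>e\<in>E. (P \<omega> \<inter> cell U lb (fst e)) \<times> (P \<omega> \<inter> cell U lb (snd e)))"
    using E(2) P_space[OF w] by (auto simp: off_diag_def labset_eq_UN cell_def irrefl_def) force+
  then have "pairs (labset U lb E) \<omega> = (\<Sum>e\<in>E. card ((P \<omega> \<inter> cell U lb (fst e)) \<times> (P \<omega> \<inter> cell U lb (snd e))))"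
    unfolding pairs_def using E finite_P[OF w]
    by (simp only:) (intro card_UN_disjoint, auto simp: cell_def)
  also have "\<dots> = (\<Sum>e\<in>E. card (P \<omega> \<inter> cell U lb (fst e)) * card (P \<omega> \<inter> cell U lb (snd e)))"
    by (simp only: card_cartesian_product)
  also have "\<dots> = edges E (\<lambda>i. if i < n then card (P \<omega> \<inter> cell U lb i) else 0)"
  proof -
    have "card (P \<omega> \<inter> cell U lb i) = (if i < n then card (P \<omega> \<inter> cell U lb i) else 0)" for i
    proof (cases "i < n")
      case False
      then have "cell U lb i = {}" using lb by (auto simp: cell_def)
      then show ?thesis by simp
    qed simp
    then show ?thesis unfolding edges_def by (intro sum.cong) auto
  qed
  finally show ?thesis .
qed

lemma pairs_labset_poisson:
  assumes lb: "labelling U lb" and E: "sym E" "irrefl E"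
    and C: "C \<in> sets (U \<Otimes>\<^sub>M U)"
    and k: "k \<ge> 0" "\<And>x. x \<in> space U \<Longrightarrow> measure U (Pair x -` C) \<le> k"
    and m: "m = measure (U \<Otimes>\<^sub>M U) (labset U lb E)"
  shows "\<bar>prob {\<omega> \<in> space M. pairs (labset U lb E) \<omega> div 2 \<in> A}
      - measure_pmf.prob (poisson0_pmf (m / 2)) A\<bar>
    \<le> 2 * exp (m / 2) * (k * m + measure U (space U) * measure (U \<Otimes>\<^sub>M U) (labset U lb E - C))"
proof -
  obtain n where n: "lb ` space U \<subseteq> {..<n}"
    using lb finite_nat_iff_bounded unfolding labelling_def by blast
  \<comment> \<open>\<open>E\<close> may be infinite; restricting it to labels below
    \<open>n\<close> leaves its label set unchanged.\<close>
  define F where "F = E \<inter> {..<n} \<times> {..<n}"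
  have F: "finite F" "sym F" "irrefl F" "F \<subseteq> {..<n} \<times> {..<n}"
    using E by (auto simp: F_def sym_def irrefl_def)
  have EF: "labset U lb E = labset U lb F"
    using n by (auto simp: F_def labset_def space_pair_measure)
  define a where "a = (\<lambda>i. measure U (cell U lb i))"
  define Y where "Y = (\<lambda>\<omega> i. if i < n then card (P \<omega> \<inter> cell U lb i) else 0)"
  have dis: "disjoint_family_on (cell U lb) {..<n}" by (auto simp: disjoint_family_on_def cell_def)
  have cells: "\<forall>i<n. cell U lb i \<in> sets U" using sets_cell[OF lb] by simp
  note law = counts_joint_law[OF cells dis Y_def]
  have "prob {\<omega> \<in> space M. pairs (labset U lb E) \<omega> div 2 \<in> A} = prob (Y -` {y. edges F y div 2 \<in> A} \<inter> space M)"
    using pairs_labset[OF n F(1,3)] by (intro arg_cong[of _ _ prob]) (auto simp: Y_def EF)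
  also have "\<dots> = measure (distr M (count_space UNIV) Y) {y. edges F y div 2 \<in> A}"
    using law(1) by (subst measure_distr) auto
  also have "\<dots> = measure_pmf.prob (Pi_pmf {..<n} 0 (\<lambda>i. poisson0_pmf (a i))) {y. edges F y div 2 \<in> A}"
    unfolding law(2) a_def ..
  finally have 1: "prob {\<omega> \<in> space M. pairs (labset U lb E) \<omega> div 2 \<in> A}
    = measure_pmf.prob (Pi_pmf {..<n} 0 (\<lambda>i. poisson0_pmf (a i))) {y. edges F y div 2 \<in> A}" .
  have m': "m / 2 = (\<Sum>(i, j)\<in>F. a i * a j) / 2"
    unfolding m EF U.measure_labset[OF lb F(1)] a_def ..
  have "\<bar>prob {\<omega> \<in> space M. pairs (labset U lb E) \<omega> div 2 \<in> A}
      - measure_pmf.prob (poisson0_pmf (m / 2)) A\<bar> \<le> 2 * exp (m / 2) * (\<Sum>(i, j)\<in>F. a i * a j * nbs F i a)"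
    unfolding 1 by (rule edges_poisson_stein[OF _ F(4,2,3) _ m']) (auto simp: a_def)
  also have "\<dots> \<le> 2 * exp (m / 2) * (k * m + measure U (space U) * measure (U \<Otimes>\<^sub>M U) (labset U lb E - C))"
    unfolding m EF by (intro mult_left_mono U.path_sum_bound[OF lb F(1) C k a_def]) auto
  finally show ?thesis .
qed

text \<open>For an approximation \<open>S\<close> of \<open>C\<close> within \<open>e\<close>, the
  two counts differ with probability at most \<open>e\<close>, the discrete bound applies to
  \<open>S\<close>, and the Poisson rate moves by at most \<open>e\<close>. Letting \<open>e\<close>
  tend to zero leaves the stated bound.\<close>

lemma pairs_poisson_approximation:
  assumes U: "diffuse U" and C: "C \<in> sets (U \<Otimes>\<^sub>M U)" "sym C"
    and k: "k \<ge> 0" "\<And>x. x \<in> space U \<Longrightarrow> measure U (Pair x -` C) \<le> k"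
    and m: "m = measure (U \<Otimes>\<^sub>M U) C"
  shows "\<bar>prob {\<omega> \<in> space M. pairs C \<omega> div 2 \<in> A} - measure_pmf.prob (poisson0_pmf (m / 2)) A\<bar>
    \<le> 2 * exp (m / 2 + 1) * k * m"
proof -
  interpret UU: finite_measure "U \<Otimes>\<^sub>M U" by (rule finite_measure_pair) unfold_locales
  have m0: "m \<ge> 0" by (simp add: m)
  define T where "T = measure U (space U)"
  \<comment> \<open>Collects the coefficients of \<open>e\<close>: two from comparing the counts and
    the Poisson rates, the rest from the discrete Stein bound.\<close>
  define K where "K = 2 + 2 * exp (m / 2 + 1) * (k + T)"
  have T0: "T \<ge> 0" by (simp add: T_def)
  have K0: "K > 0" unfolding K_def using T0 k(1) by (intro add_pos_nonneg) auto
  have bound: "\<bar>prob {\<omega> \<in> space M. pairs C \<omega> div 2 \<in> A} - measure_pmf.prob (poisson0_pmf (m / 2)) A\<bar>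
    \<le> 2 * exp (m / 2 + 1) * k * m + K * e" if e: "0 < e" "e \<le> 1" for e
  proof -
    obtain lb E where lb: "labelling U lb" "sym E" "irrefl E"
      and d: "measure (U \<Otimes>\<^sub>M U) (sym_diff C (labset U lb E)) < e"
      using diffuse_symmetric_approximation[OF U.finite_measure_axioms U C e(1)] by blast
    define S where "S = labset U lb E"
    define D where "D = sym_diff C S"
    have S: "S \<in> sets (U \<Otimes>\<^sub>M U)" unfolding S_def using lb(1) by (rule sets_labset)
    have D: "D \<in> sets (U \<Otimes>\<^sub>M U)" unfolding D_def using C S by auto
    have De: "measure (U \<Otimes>\<^sub>M U) D < e" using d by (simp add: D_def S_def)
    define mS where "mS = measure (U \<Otimes>\<^sub>M U) S"
    have mS: "mS \<le> m + e" "m \<le> mS + e"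
    proof -
      have "mS \<le> measure (U \<Otimes>\<^sub>M U) (C \<union> D)" unfolding mS_def
        using C D by (intro UU.finite_measure_mono) (auto simp: D_def)
      also have "\<dots> \<le> m + measure (U \<Otimes>\<^sub>M U) D" unfolding m using C D by (intro measure_Un_le)
      finally show "mS \<le> m + e" using De by simp
      have "m \<le> measure (U \<Otimes>\<^sub>M U) (S \<union> D)" unfolding m
        using S D by (intro UU.finite_measure_mono) (auto simp: D_def)
      also have "\<dots> \<le> mS + measure (U \<Otimes>\<^sub>M U) D" unfolding mS_def using S D by (intro measure_Un_le)
      finally show "m \<le> mS + e" using De by simp
    qed
    have SC: "measure (U \<Otimes>\<^sub>M U) (S - C) \<le> e"
      using De UU.finite_measure_mono[OF _ D, of "S - C"] by (auto simp: D_def)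
    define EC where "EC = {\<omega> \<in> space M. pairs C \<omega> div 2 \<in> A}"
    define ES where "ES = {\<omega> \<in> space M. pairs S \<omega> div 2 \<in> A}"
    define ED where "ED = {\<omega> \<in> space M. pairs D \<omega> \<noteq> 0}"
    note [measurable] = pairs_measurable[OF C(1)] pairs_measurable[OF S] pairs_measurable[OF D]
    have ev: "EC \<in> events" "ES \<in> events" "ED \<in> events"
      unfolding EC_def ES_def ED_def by measurable
    have same: "pairs C \<omega> = pairs S \<omega>" if "\<omega> \<in> space M" "\<omega> \<notin> ED" for \<omega>
    proof -
      have "off_diag D \<omega> = {}" using that finite_off_diag[of \<omega> D] by (simp add: ED_def pairs_def)
      then have "off_diag C \<omega> = off_diag S \<omega>" unfolding off_diag_def D_def by blast
      then show ?thesis by (simp add: pairs_def)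
    qed
    have "prob EC \<le> prob (ES \<union> ED)" "prob ES \<le> prob (EC \<union> ED)"
      using ev same by (auto intro!: finite_measure_mono simp: EC_def ES_def)
    moreover have "prob (ES \<union> ED) \<le> prob ES + prob ED" "prob (EC \<union> ED) \<le> prob EC + prob ED"
      using ev by (auto intro!: measure_Un_le)
    moreover have "prob ED \<le> e" using pairs_markov[OF D] De by (simp add: ED_def)
    ultimately have 1: "\<bar>prob EC - prob ES\<bar> \<le> e" by linarith
    have "\<bar>prob ES - measure_pmf.prob (poisson0_pmf (mS / 2)) A\<bar>
        \<le> 2 * exp (mS / 2) * (k * mS + T * measure (U \<Otimes>\<^sub>M U) (S - C))"
      using pairs_labset_poisson[OF lb C(1) k mS_def[unfolded S_def], of A] by (simp add: ES_def S_def T_def)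
    \<comment> \<open>The \<open>+ 1\<close> in the exponent absorbs \<open>mS \<le> m + e\<close>
      with \<open>e \<le> 1\<close>, which makes the prefactor independent of
      \<open>e\<close>.\<close>
    also have "\<dots> \<le> 2 * exp (m / 2 + 1) * (k * (m + e) + T * e)"
      using mS SC e k T0 m0
      by (intro mult_mono add_mono) (auto intro!: add_nonneg_nonneg mult_nonneg_nonneg simp: mS_def)
    finally have 2: "\<bar>prob ES - measure_pmf.prob (poisson0_pmf (mS / 2)) A\<bar>
        \<le> 2 * exp (m / 2 + 1) * (k * (m + e) + T * e)" .
    have "\<bar>measure_pmf.prob (poisson0_pmf (mS / 2)) A - measure_pmf.prob (poisson0_pmf (m / 2)) A\<bar> \<le> \<bar>mS / 2 - m / 2\<bar>"
      by (rule poisson0_prob_lipschitz) (auto simp: m mS_def)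
    also have "\<dots> \<le> e" using mS e by auto
    finally have 3: "\<bar>measure_pmf.prob (poisson0_pmf (mS / 2)) A - measure_pmf.prob (poisson0_pmf (m / 2)) A\<bar> \<le> e" .
    have "\<bar>prob EC - measure_pmf.prob (poisson0_pmf (m / 2)) A\<bar> \<le> e + 2 * exp (m / 2 + 1) * (k * (m + e) + T * e) + e"
      using 1 2 3 by linarith
    also have "\<dots> = 2 * exp (m / 2 + 1) * k * m + K * e" by (simp add: K_def algebra_simps)
    finally show ?thesis unfolding EC_def .
  qed
  show ?thesis
  proof (rule field_le_epsilon)
    fix d :: real assume d: "d > 0"
    define e where "e = min 1 (d / K)"
    have e: "0 < e" "e \<le> 1" "K * e \<le> d" using d K0 by (auto simp: e_def min_def field_simps)
    then show "\<bar>prob {\<omega> \<in> space M. pairs C \<omega> div 2 \<in> A} - measure_pmf.prob (poisson0_pmf (m / 2)) A\<bar>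
      \<le> 2 * exp (m / 2 + 1) * k * m + d"
      using bound[of e] by linarith
  qed
qed

end

section \<open>The process in the unit cube\<close>

definition window :: "real \<Rightarrow> 'a::euclidean_space measure" where
  "window l = scale_measure (ennreal l) (restrict_space lborel cubeW)"

lemma cubeW_borel [measurable]: "cubeW \<in> sets borel"
  by (simp add: cubeW_def)

lemma space_window [simp]: "space (window l) = cubeW"
  using sets_eq_imp_space_eq[of "window l" "restrict_space lborel cubeW"]
  by (simp add: window_def space_restrict_space)

lemma sets_window: "sets (window l) = sets (restrict_space lborel cubeW)"
  by (simp add: window_def)

lemma sets_window_iff: "A \<in> sets (window l) \<longleftrightarrow> A \<subseteq> cubeW \<and> A \<in> sets borel"
  using cubeW_borel unfolding sets_window by (subst sets_restrict_space_iff) auto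

lemma measure_window:
  assumes "l \<ge> 0" "A \<subseteq> cubeW"
  shows "measure (window l) A = l * measure lborel A"
  using assms by (simp add: window_def measure_restrict_space)

lemma window_measurable_ident: "(\<lambda>x. x) \<in> measurable (window l) borel"
  by (rule measurableI) (auto simp: sets_window_iff)

lemma emeasure_cubeW_finite: "emeasure lborel (cubeW :: 'a::euclidean_space set) < \<infinity>"
  unfolding cubeW_def by (rule emeasure_lborel_cbox_finite)

lemma finite_measure_window: "finite_measure (window l :: 'a::euclidean_space measure)"
proof
  have "emeasure (window l) (cubeW :: 'a set) = ennreal l * emeasure lborel (cubeW :: 'a set)"
    by (simp add: window_def emeasure_restrict_space)
  also have "\<dots> \<noteq> \<infinity>" using emeasure_cubeW_finite[where 'a = 'a] by (auto simp: ennreal_mult_eq_top_iff)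
  finally show "emeasure (window l) (space (window l :: 'a measure)) \<noteq> \<infinity>" by simp
qed

lemma hyperplane_null_sets:
  fixes b :: "'a::euclidean_space"
  assumes "b \<in> Basis"
  shows "{y. y \<bullet> b = c} \<in> null_sets lborel"
proof -
  have "{y. y \<bullet> b = c} \<in> null_sets lebesgue"
    using negligible_standard_hyperplane[OF assms, of c] by (simp add: negligible_iff_null_sets inner_commute)
  then show ?thesis by (subst (asm) null_sets_completion_iff) auto
qed

text \<open>Slicing along one coordinate suffices: the slabs around the diagonal shrink to a null set.\<close>

lemma diffuse_window:
  assumes l: "l > 0"
  shows "diffuse (window l :: 'a::euclidean_space measure)"
  unfolding diffuse_def
proof (intro allI impI)
  let ?U = "window l :: 'a measure"
  interpret U: finite_measure ?U by (rule finite_measure_window)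
  interpret UU: finite_measure "?U \<Otimes>\<^sub>M ?U" by (rule finite_measure_pair) unfold_locales
  fix e :: real assume e: "e > 0"
  obtain b :: 'a where b: "b \<in> Basis" using nonempty_Basis by blast
  have [measurable]: "(\<lambda>x. x) \<in> measurable ?U borel" by (rule window_measurable_ident)
  have ib[measurable]: "(\<lambda>x. x \<bullet> b) \<in> borel_measurable ?U" by measurable
  have [measurable]: "(\<lambda>p. fst p \<bullet> b) \<in> borel_measurable (?U \<Otimes>\<^sub>M ?U)"
    "(\<lambda>p. snd p \<bullet> b) \<in> borel_measurable (?U \<Otimes>\<^sub>M ?U)"
    using measurable_compose[OF measurable_fst ib] measurable_compose[OF measurable_snd ib] by auto
  define D where "D n = {p \<in> space (?U \<Otimes>\<^sub>M ?U). \<bar>fst p \<bullet> b - snd p \<bullet> b\<bar> \<le> 1 / real (Suc n)}" for n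
  have Dm[measurable]: "D n \<in> sets (?U \<Otimes>\<^sub>M ?U)" for n unfolding D_def by measurable
  define Z where "Z = {p \<in> space (?U \<Otimes>\<^sub>M ?U). fst p \<bullet> b = snd p \<bullet> b}"
  have Zm: "Z \<in> sets (?U \<Otimes>\<^sub>M ?U)" unfolding Z_def by measurable
  have "decseq D"
  proof (rule decseq_SucI)
    fix n
    have "1 / real (Suc (Suc n)) \<le> 1 / real (Suc n)" by (simp add: frac_le)
    then show "D (Suc n) \<subseteq> D n" unfolding D_def by (auto intro: order_trans)
  qed
  then have lim: "(\<lambda>n. measure (?U \<Otimes>\<^sub>M ?U) (D n)) \<longlonglongrightarrow> measure (?U \<Otimes>\<^sub>M ?U) (\<Inter>n. D n)"
    by (intro UU.finite_Lim_measure_decseq) auto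
  have "(\<Inter>n. D n) \<subseteq> Z"
  proof
    fix p assume p: "p \<in> (\<Inter>n. D n)"
    have "\<bar>fst p \<bullet> b - snd p \<bullet> b\<bar> \<le> 0"
    proof (rule field_le_epsilon)
      fix d :: real assume "d > 0"
      then obtain n where "inverse (real (Suc n)) < d" using reals_Archimedean by blast
      moreover have "\<bar>fst p \<bullet> b - snd p \<bullet> b\<bar> \<le> 1 / real (Suc n)" using p by (auto simp: D_def)
      ultimately show "\<bar>fst p \<bullet> b - snd p \<bullet> b\<bar> \<le> 0 + d" by (simp add: inverse_eq_divide)
    qed
    then show "p \<in> Z" using p by (auto simp: Z_def D_def)
  qed
  then have "measure (?U \<Otimes>\<^sub>M ?U) (\<Inter>n. D n) \<le> measure (?U \<Otimes>\<^sub>M ?U) Z"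
    using Zm by (rule UU.finite_measure_mono)
  moreover have "emeasure (?U \<Otimes>\<^sub>M ?U) Z = 0"
  proof -
    \<comment> \<open>For fixed \<open>x\<close> the section lies in a hyperplane orthogonal to
      \<open>b\<close>.\<close>
    have "emeasure ?U (Pair x -` Z) = 0" for x
    proof -
      have "Pair x -` Z \<in> sets ?U" using Zm by (rule sets_Pair1)
      then have s: "Pair x -` Z \<subseteq> cubeW" "Pair x -` Z \<in> sets lborel" by (auto simp: sets_window_iff)
      have "emeasure lborel (Pair x -` Z) \<le> emeasure lborel {y. y \<bullet> b = x \<bullet> b}"
        by (rule emeasure_mono) (auto simp: Z_def)
      also have "\<dots> = 0" using hyperplane_null_sets[OF b] by auto
      finally show ?thesis using s by (simp add: window_def emeasure_restrict_space)
    qed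
    then show ?thesis by (simp add: U.emeasure_pair_measure_alt[OF Zm])
  qed
  ultimately have "measure (?U \<Otimes>\<^sub>M ?U) (\<Inter>n. D n) = 0"
    using measure_nonneg[of "?U \<Otimes>\<^sub>M ?U" "\<Inter>n. D n"]
    by (intro antisym) (simp_all add: measure_eq_emeasure_eq_ennreal[of 0 _ Z])
  then have "\<forall>\<^sub>F n in sequentially. measure (?U \<Otimes>\<^sub>M ?U) (D n) < e"
    using lim e by (intro order_tendstoD) auto
  then obtain n where n: "measure (?U \<Otimes>\<^sub>M ?U) (D n) < e" by (auto simp: eventually_sequentially)
  define k where "k = real (Suc n)"
  \<comment> \<open>The labels are strips of width \<open>1 / k\<close>. Coordinates on
    \<open>cubeW\<close> are at least \<open>-1/2\<close>, so after the shift by \<open>1\<close>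
    the floor is nonnegative and \<open>nat\<close> merges no strips.\<close>
  define lb where "lb x = nat \<lfloor>k * (x \<bullet> b + 1)\<rfloor>" for x
  have W: "\<bar>x \<bullet> b\<bar> \<le> 1 / 2" if "x \<in> cubeW" for x
    using that b by (auto simp: cubeW_def mem_box inner_Basis dest!: bspec[of _ _ b] simp: inner_sum_left_Basis abs_le_iff)
  have k: "k > 0" by (simp add: k_def)
  have "lb \<in> measurable ?U (count_space UNIV)" unfolding lb_def by measurable
  moreover have "lb ` space ?U \<subseteq> {..nat \<lfloor>k * 2\<rfloor>}"
  proof -
    have "k * (x \<bullet> b + 1) \<le> k * 2" if "x \<in> cubeW" for x
      using W[OF that] k by (intro mult_left_mono) auto
    then show ?thesis by (auto simp: lb_def intro!: nat_mono floor_mono)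
  qed
  then have "finite (lb ` space ?U)" by (rule finite_subset) simp
  ultimately have lb: "labelling ?U lb" by (simp add: labelling_def)
  have "labset ?U lb Id \<subseteq> D n"
  proof
    fix p assume p: "p \<in> labset ?U lb Id"
    let ?x = "fst p" and ?y = "snd p"
    have xy: "?x \<in> cubeW" "?y \<in> cubeW" "lb ?x = lb ?y"
      using p by (auto simp: labset_def space_pair_measure)
    have "k * (?x \<bullet> b + 1) \<ge> 0" "k * (?y \<bullet> b + 1) \<ge> 0"
      using W[OF xy(1)] W[OF xy(2)] k by auto
    then have "\<lfloor>k * (?x \<bullet> b + 1)\<rfloor> = \<lfloor>k * (?y \<bullet> b + 1)\<rfloor>"
      using xy(3) by (simp add: lb_def eq_nat_nat_iff)
    then have "\<bar>k * (?x \<bullet> b + 1) - k * (?y \<bullet> b + 1)\<bar> \<le> 1" by linarith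
    also have "k * (?x \<bullet> b + 1) - k * (?y \<bullet> b + 1) = k * (?x \<bullet> b - ?y \<bullet> b)" by (simp add: algebra_simps)
    finally have "\<bar>?x \<bullet> b - ?y \<bullet> b\<bar> \<le> 1 / k" using k by (simp add: abs_mult pos_le_divide_eq mult.commute)
    then show "p \<in> D n" using p by (auto simp: D_def k_def labset_def)
  qed
  then have "measure (?U \<Otimes>\<^sub>M ?U) (labset ?U lb Id) < e"
    using UU.finite_measure_mono[OF _ Dm, of "labset ?U lb Id" n] n by simp
  then show "\<exists>lb. labelling ?U lb \<and> measure (?U \<Otimes>\<^sub>M ?U) (labset ?U lb Id) < e" using lb by blast
qed

text \<open>Subsets of \<open>cubeW\<close> are bounded, so the count laws, given for bounded Borel
  sets, cover every measurable set of the window.\<close>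

lemma poisson_process_window:
  fixes eta :: "'b \<Rightarrow> 'a::euclidean_space set"
  assumes pp: "poisson_process M l eta" and l: "l > 0"
  shows "poisson_points M (window l) (\<lambda>\<omega>. eta \<omega> \<inter> cubeW)"
proof -
  have bdd: "bounded A" if "A \<subseteq> cubeW" for A :: "'a set"
    using that unfolding cubeW_def by (rule bounded_subset[OF bounded_cbox])
  interpret prob_space M using pp by (simp add: poisson_process_def)
  interpret U: finite_measure "window l :: 'a measure" by (rule finite_measure_window)
  have win: "A \<subseteq> cubeW" "A \<in> sets lborel" "bounded A" "eta \<omega> \<inter> cubeW \<inter> A = eta \<omega> \<inter> A"
    if "A \<in> sets (window l)" for A \<omega>
    using that bdd by (auto simp: sets_window_iff)
  show ?thesis
  proof
    show "finite (eta \<omega> \<inter> cubeW)" if "\<omega> \<in> space M" for \<omega>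
      using pp that bdd unfolding poisson_process_def by blast
    show "eta \<omega> \<inter> cubeW \<subseteq> space (window l)" for \<omega> by simp
    show "prob {\<omega> \<in> space M. card (eta \<omega> \<inter> cubeW \<inter> A) = k}
        = measure (window l) A ^ k / fact k * exp (- measure (window l) A)"
      if A: "A \<in> sets (window l)" for A k
    proof -
      have "prob {\<omega> \<in> space M. card (eta \<omega> \<inter> A) = k}
          = (l * measure lborel A) ^ k / fact k * exp (- (l * measure lborel A))"
        using pp win(2,3)[OF A] unfolding poisson_process_def by blast
      then show ?thesis using win[OF A] l by (simp add: measure_window)
    qed
    show "indep_vars (\<lambda>_. count_space UNIV) (\<lambda>i \<omega>. card (eta \<omega> \<inter> cubeW \<inter> As i)) {..<n}"
      if "\<forall>i<n. As i \<in> sets (window l)" "disjoint_family_on As {..<n}" for n :: nat and As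
    proof -
      have "indep_vars (\<lambda>_. count_space UNIV) (\<lambda>i \<omega>. card (eta \<omega> \<inter> As i)) {..<n}"
      proof -
        have "(\<forall>i<n. As i \<in> sets lborel \<and> bounded (As i)) \<and> disjoint_family_on As {..<n} \<longrightarrow>
            indep_vars (\<lambda>_. count_space UNIV) (\<lambda>i \<omega>. card (eta \<omega> \<inter> As i)) {..<n}"
          using pp unfolding poisson_process_def by (elim conjE) (erule allE)+
        then show ?thesis using that win(2,3) by auto
      qed
      moreover have "(\<lambda>\<omega>. card (eta \<omega> \<inter> cubeW \<inter> As i)) = (\<lambda>\<omega>. card (eta \<omega> \<inter> As i))" if "i \<in> {..<n}" for i
        using that \<open>\<forall>i<n. As i \<in> sets (window l)\<close> win(4) by auto
      ultimately show ?thesis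
        using indep_vars_cong[OF refl _ refl, of "{..<n}" "\<lambda>i \<omega>. card (eta \<omega> \<inter> cubeW \<inter> As i)"
            "\<lambda>i \<omega>. card (eta \<omega> \<inter> As i)" "\<lambda>_. count_space UNIV"] by simp
    qed
  qed
qed

section \<open>Transfer to the random geometric graph\<close>

lemma measure_lborel_reflect:
  fixes A :: "'a::euclidean_space set"
  assumes "A \<in> sets borel"
  shows "measure lborel ((\<lambda>y. x - y) -` A) = measure lborel A"
proof -
  have "lborel = distr lborel borel (\<lambda>y. x - y)"
    using lborel_affine[of "-1" x] by (simp add: density_1)
  then have "measure lborel A = measure (distr lborel borel (\<lambda>y. x - y)) A" by simp
  then show ?thesis using assms by (simp add: measure_distr)
qed

text \<open>The estimate at a fixed \<open>l\<close>. Differences of points of \<open>cubeW\<close>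
  lie in \<open>cubeW_hat\<close>, so every section of the edge relation has mass at most
  \<open>k\<close>; this controls the degrees and, integrated over the window, the mean
  \<open>m\<close> of the double sum.\<close>

lemma rgg_poisson_bound:
  fixes eta :: "'b \<Rightarrow> 'a::euclidean_space set"
  assumes pp: "poisson_process M l eta" and l: "l > 0"
    and H: "H \<in> sets borel" "0 \<notin> H" "\<And>z. z \<in> H \<Longrightarrow> - z \<in> H"
    and c: "c > 0"
    and k: "k = l * measure lborel (H \<inter> cubeW_hat)"
  obtains m where
    "0 \<le> m" "m \<le> k * (l * measure lborel (cubeW :: 'a set))"
    "prob_space.expectation M (\<lambda>\<omega>. rgg_F H (eta \<omega>) / 2) = m / 2"
    "dTV_poisson M (\<lambda>\<omega>. rgg_F H (eta \<omega>) / 2) (c / 2)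
      \<le> \<bar>m / 2 - c / 2\<bar> + 2 * exp (m / 2 + 1) * k * m"
proof -
  let ?U = "window l :: 'a measure"
  interpret poisson_points M ?U "\<lambda>\<omega>. eta \<omega> \<inter> cubeW" by (rule poisson_process_window[OF pp l])
  interpret UU: finite_measure "?U \<Otimes>\<^sub>M ?U" by (rule finite_measure_pair) unfold_locales
  define C where "C = {p \<in> space (?U \<Otimes>\<^sub>M ?U). fst p - snd p \<in> H}"
  have id[measurable]: "(\<lambda>x. x) \<in> measurable ?U borel" by (rule window_measurable_ident)
  have [measurable]: "fst \<in> borel_measurable (?U \<Otimes>\<^sub>M ?U)" "snd \<in> borel_measurable (?U \<Otimes>\<^sub>M ?U)"
    using measurable_compose[OF measurable_fst id] measurable_compose[OF measurable_snd id] by auto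
  note H(1)[measurable]
  have C: "C \<in> sets (?U \<Otimes>\<^sub>M ?U)" unfolding C_def by measurable
  have symC: "sym C" using H(3) by (auto simp: sym_def C_def space_pair_measure) (metis minus_diff_eq)
  have k0: "k \<ge> 0" using l k by simp
  have hat: "cubeW_hat \<in> sets (borel :: 'a measure)" "bounded (cubeW_hat :: 'a set)"
    by (simp_all add: cubeW_hat_def)
  have sec: "measure ?U (Pair x -` C) \<le> k" if x: "x \<in> space ?U" for x
  proof -
    have "Pair x -` C \<in> sets ?U" using C by (rule sets_Pair1)
    then have s: "Pair x -` C \<subseteq> cubeW" "Pair x -` C \<in> sets borel" by (auto simp: sets_window_iff)
    let ?A = "(\<lambda>y. x - y) -` (H \<inter> cubeW_hat)"
    have A: "?A \<in> sets borel"
      using measurable_sets[of "\<lambda>y. x - y" borel borel "H \<inter> cubeW_hat"] H(1) hat by simp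
    have "Pair x -` C \<subseteq> ?A"
    proof
      fix y assume "y \<in> Pair x -` C"
      then have y: "y \<in> cubeW" "x - y \<in> H" by (auto simp: C_def space_pair_measure)
      then have "x - y \<in> cubeW_hat" using x
        by (fastforce simp: cubeW_def cubeW_hat_def mem_box inner_diff_left inner_sum_left_Basis)
      then show "y \<in> ?A" using y by simp
    qed
    \<comment> \<open>\<open>measure\<close> sends infinite mass to \<open>0\<close>, so
      monotonicity requires the larger set to have finite mass.\<close>
    moreover have "emeasure lborel ?A < \<infinity>"
    proof -
      obtain R where R: "\<And>z. z \<in> (cubeW_hat :: 'a set) \<Longrightarrow> norm z \<le> R"
        using hat(2) unfolding bounded_iff by blast
      have "norm y \<le> norm x + R" if "y \<in> ?A" for y
        using that R[of "x - y"] norm_triangle_ineq4[of x "x - y"] by simp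
      then have "bounded ?A" unfolding bounded_iff by blast
      then show ?thesis by (rule emeasure_bounded_finite)
    qed
    ultimately have "measure lborel (Pair x -` C) \<le> measure lborel ?A"
      using s A by (intro measure_mono_fmeasurable) (auto simp: fmeasurable_def)
    also have "\<dots> = measure lborel (H \<inter> cubeW_hat)"
      using H(1) hat by (intro measure_lborel_reflect) auto
    finally show ?thesis using s l by (simp add: measure_window k mult_left_mono)
  qed
  have F: "rgg_F H (eta \<omega>) = real (pairs C \<omega>)" if w: "\<omega> \<in> space M" for \<omega>
  proof -
    let ?P = "eta \<omega> \<inter> cubeW"
    have "finite ?P" using finite_P[OF w] .
    \<comment> \<open>As \<open>0 \<notin> H\<close>, no point is related to itself, and the
      off-diagonal pairs are exactly the terms of the double sum.\<close>
    moreover have "off_diag C \<omega> = {p \<in> ?P \<times> ?P. fst p - snd p \<in> H}"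
      using H(2) by (auto simp: off_diag_def C_def space_pair_measure)
    moreover have "rgg_F H (eta \<omega>) = (\<Sum>p\<in>?P \<times> ?P. if fst p - snd p \<in> H then 1 else 0)"
      unfolding rgg_F_def by (simp add: sum.cartesian_product case_prod_unfold)
    ultimately show ?thesis
      unfolding pairs_def by (simp add: sum.If_cases Int_def)
  qed
  have F2: "rgg_F H (eta \<omega>) / 2 = real (pairs C \<omega> div 2)" if w: "\<omega> \<in> space M" for \<omega>
  proof -
    have "even (pairs C \<omega>)"
      unfolding pairs_def
    proof (rule even_card_sym_irrefl)
      show "finite (off_diag C \<omega>)" by (rule finite_off_diag[OF w])
      show "sym (off_diag C \<omega>)" using symC by (auto simp: off_diag_def sym_def)
      show "irrefl (off_diag C \<omega>)" by (auto simp: off_diag_def irrefl_def)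
    qed
    then show ?thesis using F[OF w] by (auto elim!: evenE)
  qed
  define m where "m = measure (?U \<Otimes>\<^sub>M ?U) C"
  have "m \<ge> 0" by (simp add: m_def)
  moreover have "m \<le> k * (l * measure lborel (cubeW :: 'a set))"
  proof -
    have "emeasure (?U \<Otimes>\<^sub>M ?U) C = (\<integral>\<^sup>+x. emeasure ?U (Pair x -` C) \<partial>?U)"
      by (rule U.emeasure_pair_measure_alt[OF C])
    also have "\<dots> \<le> (\<integral>\<^sup>+x. ennreal k \<partial>?U)"
      by (rule nn_integral_mono) (use sec in \<open>auto simp: U.emeasure_eq_measure intro!: ennreal_leI\<close>)
    also have "\<dots> = ennreal (k * (l * measure lborel (cubeW :: 'a set)))"
      using k0 l by (simp add: U.emeasure_eq_measure measure_window ennreal_mult)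
    finally show ?thesis
      unfolding m_def UU.emeasure_eq_measure using k0 l by (subst (asm) ennreal_le_iff) auto
  qed
  moreover have "expectation (\<lambda>\<omega>. rgg_F H (eta \<omega>) / 2) = m / 2"
  proof -
    have "expectation (\<lambda>\<omega>. rgg_F H (eta \<omega>) / 2) = expectation (\<lambda>\<omega>. real (pairs C \<omega>) / 2)"
      by (rule Bochner_Integration.integral_cong) (simp_all add: F)
    then show ?thesis using pairs_expectation[OF C] by (simp add: m_def)
  qed
  moreover have "dTV_poisson M (\<lambda>\<omega>. rgg_F H (eta \<omega>) / 2) (c / 2)
      \<le> \<bar>m / 2 - c / 2\<bar> + 2 * exp (m / 2 + 1) * k * m"
    unfolding dTV_poisson_def
  proof (rule cSUP_least)
    fix A :: "nat set"
    have ev: "{\<omega> \<in> space M. rgg_F H (eta \<omega>) / 2 \<in> real ` A} = {\<omega> \<in> space M. pairs C \<omega> div 2 \<in> A}"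
      using F2 by auto
    have "\<bar>prob {\<omega> \<in> space M. pairs C \<omega> div 2 \<in> A} - measure_pmf.prob (poisson0_pmf (m / 2)) A\<bar>
        \<le> 2 * exp (m / 2 + 1) * k * m"
      by (rule pairs_poisson_approximation[OF diffuse_window[OF l] C symC k0 sec m_def])
    moreover have "\<bar>measure_pmf.prob (poisson0_pmf (m / 2)) A - measure_pmf.prob (poisson0_pmf (c / 2)) A\<bar>
        \<le> \<bar>m / 2 - c / 2\<bar>"
      by (rule poisson0_prob_lipschitz) (use c in \<open>auto simp: m_def\<close>)
    \<comment> \<open>The target rate is positive, whereas \<open>m / 2\<close> may be zero; only
      the latter needs the extended convention.\<close>
    moreover have po: "poisson0_pmf (c / 2) = poisson_pmf (c / 2)" using c by (simp add: poisson0_pmf_def)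
    ultimately show "\<bar>prob {\<omega> \<in> space M. rgg_F H (eta \<omega>) / 2 \<in> real ` A}
        - measure_pmf.prob (poisson_pmf (c / 2)) A\<bar> \<le> \<bar>m / 2 - c / 2\<bar> + 2 * exp (m / 2 + 1) * k * m"
      unfolding ev po[symmetric] by linarith
  qed simp
  ultimately show thesis by (intro that)
qed

text \<open>The fixed-rate error is \<open>2 * exp (m / 2 + 1) * k * m\<close>. Comparability of the
  occupation coefficients makes \<open>k\<close> of order \<open>l * psi\<close>, and boundedness of
  \<open>l\<^sup>2 * psi\<close> bounds \<open>m\<close>; eventually \<open>l * psi < 1\<close>, so
  the error is of order \<open>sqrt (l * psi)\<close>.\<close>

theorem theorem5p1:
  fixes M :: "real \<Rightarrow> 'b measure"
    and eta :: "real \<Rightarrow> 'b \<Rightarrow> 'a::euclidean_space set"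
    and Hb :: "real \<Rightarrow> 'a set"
    and c :: real
  assumes pp: "\<And>l. l > 0 \<Longrightarrow> poisson_process (M l) l (eta l)"
    and Hb_borel: "\<And>l. l > 0 \<Longrightarrow> Hb l \<in> sets lborel"
    and Hb_zero: "\<And>l. l > 0 \<Longrightarrow> 0 \<notin> Hb l"
    and Hb_sym: "\<And>l z. l > 0 \<Longrightarrow> z \<in> Hb l \<Longrightarrow> - z \<in> Hb l"
    and occ: "asymp_comparable (\<lambda>l. measure lborel (Hb l \<inter> cubeW_hat))
                               (\<lambda>l. measure lborel (Hb l \<inter> cubeW_check))"
    and lpsi: "((\<lambda>l. l * measure lborel (Hb l \<inter> cubeW)) \<longlongrightarrow> 0) at_top"
    and l2psi: "\<exists>B. \<forall>l>0. \<bar>l\<^sup>2 * measure lborel (Hb l \<inter> cubeW)\<bar> \<le> B"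
    and c_pos: "c > 0"
    and var: "((\<lambda>l. prob_space.variance (M l) (\<lambda>\<omega>. rgg_F (Hb l) (eta l \<omega>))) \<longlongrightarrow> 2 * c) at_top"
  shows "\<exists>K::real. \<forall>\<^sub>F l in at_top.
           dTV_poisson (M l) (\<lambda>\<omega>. rgg_F (Hb l) (eta l \<omega>) / 2) (c / 2)
             \<le> \<bar>prob_space.expectation (M l) (\<lambda>\<omega>. rgg_F (Hb l) (eta l \<omega>) / 2) - c / 2\<bar>
               + K * sqrt (l * measure lborel (Hb l \<inter> cubeW))"
proof -
  obtain C' where C': "C' > 0" and occ': "\<forall>\<^sub>F l in at_top.
      measure lborel (Hb l \<inter> cubeW_hat) \<le> C' * measure lborel (Hb l \<inter> cubeW_check)"
  proof -
    from occ obtain C C' where "C' > 0" and *: "\<forall>\<^sub>F l in at_top.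
        C * measure lborel (Hb l \<inter> cubeW_check) \<le> measure lborel (Hb l \<inter> cubeW_hat) \<and>
        measure lborel (Hb l \<inter> cubeW_hat) \<le> C' * measure lborel (Hb l \<inter> cubeW_check)"
      unfolding asymp_comparable_def by blast
    from * have "\<forall>\<^sub>F l in at_top.
        measure lborel (Hb l \<inter> cubeW_hat) \<le> C' * measure lborel (Hb l \<inter> cubeW_check)"
      by (rule eventually_mono) simp
    with \<open>C' > 0\<close> show thesis by (rule that)
  qed
  obtain B where B: "\<And>l. l > 0 \<Longrightarrow> \<bar>l\<^sup>2 * measure lborel (Hb l \<inter> cubeW)\<bar> \<le> B" using l2psi by blast
  have B0: "B \<ge> 0" using B[of 1] by linarith
  define T where "T = measure lborel (cubeW :: 'a set)"
  \<comment> \<open>An upper bound for the mean \<open>m\<close>: \<open>m \<le> k * l * T \<le> C'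
    * (l\<^sup>2 * psi) * T \<le> C' * B * T\<close>.\<close>
  define b where "b = C' * B * T"
  have T0: "T \<ge> 0" by (simp add: T_def)
  have b0: "b \<ge> 0" using B0 T0 C' by (simp add: b_def)
  have "\<forall>\<^sub>F l in at_top. l * measure lborel (Hb l \<inter> cubeW) < 1"
    using lpsi by (rule order_tendstoD) simp
  with occ' eventually_gt_at_top[of 0]
  have "\<forall>\<^sub>F l in at_top. dTV_poisson (M l) (\<lambda>\<omega>. rgg_F (Hb l) (eta l \<omega>) / 2) (c / 2)
             \<le> \<bar>prob_space.expectation (M l) (\<lambda>\<omega>. rgg_F (Hb l) (eta l \<omega>) / 2) - c / 2\<bar>
               + (2 * exp (b / 2 + 1) * C' * b) * sqrt (l * measure lborel (Hb l \<inter> cubeW))"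
  proof eventually_elim
    case (elim l)
    define psi where "psi = measure lborel (Hb l \<inter> cubeW)"
    define k where "k = l * measure lborel (Hb l \<inter> cubeW_hat)"
    have l: "l > 0" and small: "l * psi < 1" using elim by (auto simp: psi_def)
    have psi0: "psi \<ge> 0" by (simp add: psi_def)
    have H: "Hb l \<in> sets borel" using Hb_borel[OF l] by simp
    \<comment> \<open>The comparison bounds the hat coefficient by \<open>C'\<close> times the check
      coefficient, and the check cube lies inside \<open>cubeW\<close>; together they give
      \<open>C' * psi\<close>.\<close>
    have "cubeW_check \<subseteq> (cubeW :: 'a set)"
      unfolding cubeW_def cubeW_check_def
      by (rule subset_box_imp) simp
    moreover have "Hb l \<inter> cubeW \<in> fmeasurable lborel"
      using H by (intro fmeasurableI emeasure_bounded_finite bounded_Int)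
        (auto simp: cubeW_def)
    ultimately have "measure lborel (Hb l \<inter> cubeW_check) \<le> psi"
      unfolding psi_def using H
      by (intro measure_mono_fmeasurable) (auto simp: cubeW_check_def)
    then have "C' * measure lborel (Hb l \<inter> cubeW_check) \<le> C' * psi" using C' by simp
    then have "measure lborel (Hb l \<inter> cubeW_hat) \<le> C' * psi" using elim by linarith
    then have kle: "k \<le> C' * (l * psi)"
      unfolding k_def using l by (auto dest: mult_left_mono[of _ _ l] simp: mult_ac)
    obtain m where m: "0 \<le> m" "m \<le> k * (l * T)"
      and E: "prob_space.expectation (M l) (\<lambda>\<omega>. rgg_F (Hb l) (eta l \<omega>) / 2) = m / 2"
      and tv: "dTV_poisson (M l) (\<lambda>\<omega>. rgg_F (Hb l) (eta l \<omega>) / 2) (c / 2)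
        \<le> \<bar>m / 2 - c / 2\<bar> + 2 * exp (m / 2 + 1) * k * m"
      using rgg_poisson_bound[OF pp[OF l] l H Hb_zero[OF l] Hb_sym[OF l] c_pos k_def] unfolding T_def by blast
    have "k * (l * T) \<le> C' * (l * psi) * (l * T)"
      using kle l T0 by (intro mult_right_mono) auto
    also have "\<dots> = C' * (l\<^sup>2 * psi) * T" by (simp add: power2_eq_square mult_ac)
    also have "\<dots> \<le> C' * B * T"
      using B[OF l] C' T0 unfolding psi_def[symmetric] by (intro mult_right_mono mult_left_mono) auto
    finally have mb: "m \<le> b" using m(2) by (simp add: b_def)
    \<comment> \<open>A number in \<open>[0, 1]\<close> is at most its square root; this is where
      smallness of \<open>l * psi\<close> enters.\<close>
    have "l * psi \<le> sqrt (l * psi)"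
      using small l psi0 by (intro real_le_rsqrt) (auto simp: power2_eq_square mult_left_le)
    then have ks: "k \<le> C' * sqrt (l * psi)"
      using kle C' by (auto dest: mult_left_mono[of _ _ C'] intro: order_trans)
    have "2 * exp (m / 2 + 1) * k * m \<le> 2 * exp (b / 2 + 1) * (C' * sqrt (l * psi)) * b"
      using ks mb m(1) b0 C' l psi0 by (intro mult_mono) (auto simp: k_def)
    then show ?case using tv unfolding E psi_def[symmetric] by (simp add: mult_ac)
  qed
  then show ?thesis by blast
qed

end
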